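(* Let $0\le\eta < \frac{1}{2}$. For $T>0$ and $\bar\theta\in[0,1]$ consider the boundary value problem $$ (\mathrm{P}_{T,\bar\theta})\qquad \begin{cases} \frac{d^2}{dt^2}y + y-\frac{1}{2}y^3-3 \eta |y|y-4\eta^2y=0 \quad\text{on } [0,T], \\ \frac{1}{2}y(T)|y(T)|+2 \eta y(T)+\frac{d}{dt} y(T)=2\bar{\theta}-1,\\ y(0) =0 . \end{cases} $$ (1) If $|2 \bar{\theta}-1| \geq 1-\eta^2-\eta\sqrt{\eta^2+2}$, then for every $T>0$ there exists a unique solution to $(\mathrm{P}_{T,\bar\theta})$. (2) If $|2 \bar{\theta}-1| < 1-\eta^2-\eta\sqrt{\eta^2+2}$, then the number of solutions to $(\mathrm{P}_{T,\bar\theta})$ can be arbitrarily large if $T$ is large enough; that is, for every $n\in\mathbb{N}$ there is $T_*>0$ such that $(\mathrm{P}_{T,\bar\theta})$ has at least $n$ solutions for every $T\ge T_*$. (3) In particular, when $2\bar\theta-1=0$, for every $T>0$ the number of solutions to $(\mathrm{P}_{T,\bar\theta})$ is $$1+2 \sup_{k \in \mathbb{N}} \{k : T_k(0+) <T \},$$ where $\mathbb{N}=\{1,2,\dots\}$ and the supremum of the empty set is $0$.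
   Context: For $0\le\eta<\frac12$ let $G(y)=\frac{1}{4}y^4+2\eta|y|^3+4\eta^2y^2-y^2$ and $v_0:=\sqrt{-G(\sqrt{\eta^2+2}-3\eta)}$. For $v\in(0,v_0)$ let $y(v)$ be the smallest positive root of $z\mapsto G(z)+v^2$, and set $$T(v):=\int_0^{y(v)} \frac{dz}{\sqrt{G(z)+v^2}},\qquad H(v):= \int_v^{y(v)} \frac{dz}{\sqrt{G(z)+v^2}},\qquad T_k(v):=(2k-1)T(v)+H(v)\quad (k=1,2,\dots),$$ and $T_k(0+):=\lim_{v\downarrow 0}T_k(v)$. Background: $(\mathrm{P}_{T,\bar\theta})$ is the time reversal of the two-state mean field game system $\dot x = y-x|y|-2\eta x$, $-\dot y = x-\frac12 y|y|-2\eta y$, $y(T)=0$, $x(0)=2\bar\theta-1$, written as a single equation for $y$; here $x=2\theta-1$ with $\theta$ the fraction of players in state $0$, and $y=u(t,1)-u(t,0)$ is the difference of the value functions. *)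

theory Defs
  imports "HOL-Analysis.Analysis" "HOL-Library.Extended_Nat"
begin

definition G :: "real \<Rightarrow> real \<Rightarrow> real" where
  "G \<eta> y = 1/4 * y^4 + 2 * \<eta> * \<bar>y\<bar>^3 + 4 * \<eta>^2 * y^2 - y^2"

definition v0 :: "real \<Rightarrow> real" where
  "v0 \<eta> = sqrt (- G \<eta> (sqrt (\<eta>^2 + 2) - 3 * \<eta>))"

definition yroot :: "real \<Rightarrow> real \<Rightarrow> real" where
  "yroot \<eta> v = (LEAST z. 0 < z \<and> G \<eta> z + v^2 = 0)"

text \<open>The integrands below have an inverse-square-root singularity at the upper endpoint
  \<open>yroot \<eta> v\<close>; the Henstock--Kurzweil integral covers this improper case, and the value
  \<open>1 / 0 = 0\<close> at that single point is irrelevant.\<close>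

definition Tint :: "real \<Rightarrow> real \<Rightarrow> real" where
  "Tint \<eta> v = integral {0..yroot \<eta> v} (\<lambda>z. 1 / sqrt (G \<eta> z + v^2))"

definition Hint :: "real \<Rightarrow> real \<Rightarrow> real" where
  "Hint \<eta> v = integral {v..yroot \<eta> v} (\<lambda>z. 1 / sqrt (G \<eta> z + v^2))"

definition Tk :: "real \<Rightarrow> nat \<Rightarrow> real \<Rightarrow> real" where
  "Tk \<eta> k v = (2 * real k - 1) * Tint \<eta> v + Hint \<eta> v"

text \<open>\<open>Tk \<eta> k\<close> is meaningful on the interval \<open>(0, v0 \<eta>)\<close> only, so the limit
  for \<open>v\<close> decreasing to \<open>0\<close> is taken within that interval.\<close>

definition Tk0 :: "real \<Rightarrow> nat \<Rightarrow> real" where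
  "Tk0 \<eta> k = Lim (at 0 within {0<..<v0 \<eta>}) (Tk \<eta> k)"

text \<open>Classical solutions on \<open>[0, T]\<close>, with one-sided derivatives at the endpoints.
  The witnesses \<open>y'\<close> and \<open>y''\<close> are the first and second derivative; continuity of \<open>y''\<close>
  follows from the equation.\<close>

definition solves_P :: "real \<Rightarrow> real \<Rightarrow> real \<Rightarrow> (real \<Rightarrow> real) \<Rightarrow> bool" where
  "solves_P \<eta> T \<theta> y \<longleftrightarrow>
    (\<exists>y' y''.
      (\<forall>t\<in>{0..T}. (y has_real_derivative y' t) (at t within {0..T})) \<and>
      (\<forall>t\<in>{0..T}. (y' has_real_derivative y'' t) (at t within {0..T})) \<and>
      (\<forall>t\<in>{0..T}. y'' t + y t - 1/2 * (y t)^3 - 3 * \<eta> * \<bar>y t\<bar> * y t - 4 * \<eta>^2 * y t = 0) \<and>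
      1/2 * y T * \<bar>y T\<bar> + 2 * \<eta> * y T + y' T = 2 * \<theta> - 1 \<and>
      y 0 = 0)"

text \<open>A solution is a function on \<open>[0, T]\<close>; requiring the fixed value \<open>undefined\<close> outside
  that interval makes each such function correspond to exactly one HOL function, so that
  solutions can be counted.\<close>

definition solutions_P :: "real \<Rightarrow> real \<Rightarrow> real \<Rightarrow> (real \<Rightarrow> real) set" where
  "solutions_P \<eta> T \<theta> = {y \<in> extensional {0..T}. solves_P \<eta> T \<theta> y}"

end

theory Submission
  imports Defs
begin

text \<open>Put \<open>F y = y\<bar>y\<bar>/2 + 2\<eta>y\<close>. Then \<open>G = F\<^sup>2 - y\<^sup>2\<close>, a solution with initial velocity \<open>s\<close>
  satisfies the energy identity \<open>y'\<^sup>2 = G y + s\<^sup>2\<close>, and the end condition prescribes the value at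
  time \<open>T\<close> of the state \<open>x = y' + F y\<close> of the mean field game system. Solutions are therefore counted by
  their initial velocities. The system has the saddles \<open>\<plusminus>(xs, ys)\<close>, where \<open>xs\<close> is the threshold of the
  theorem, and \<open>\<bar>s\<bar> = v0\<close> are the separatrices.

  For \<open>\<bar>s\<bar> < v0\<close> the orbit is periodic with \<open>\<bar>x\<bar> < xs\<close>. With \<open>y = Y sin \<phi>\<close>, \<open>Y\<close> the amplitude, the energy
  identity becomes a regular first-order equation for \<open>\<phi>\<close>, so the time \<open>\<Theta> Y b\<close> needed to reach the angle
  \<open>b\<close> is a proper integral, continuous and strictly increasing in both arguments, and it diverges as
  \<open>Y\<close> tends to \<open>ys\<close>. The same substitution turns \<open>Tint\<close> and \<open>Hint\<close> into values of \<open>\<Theta>\<close>. The state \<open>x\<close>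
  vanishes exactly at the times \<open>Tk\<close>, which increase with \<open>Y\<close>: this gives part (3). For part (2), as the
  angle at time \<open>T\<close> runs through \<open>[\<pi>/2 + 2\<pi>k, \<pi> + 2\<pi>k]\<close> the state \<open>x\<close> falls from \<open>F Y\<close>, close to \<open>xs\<close>,
  to a negative value.

  For \<open>s \<ge> v0\<close> the orbit is increasing and can be solved by separation of variables. The velocity belonging
  to the end point \<open>(x, Y)\<close> is given by the explicit quadratic \<open>level x Y\<close>, which decreases in \<open>Y\<close> when
  \<open>x \<ge> xs\<close>. Uniqueness in part (1) follows since faster orbits travel farther; existence follows from the
  intermediate value theorem applied to the travel time as a function of \<open>Y\<close>.\<close>

subsection \<open>Separable equations and parametric integrals\<close>

text \<open>The difference quotients of \<open>q\<close> are the reciprocals of those of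
  \<open>P\<close> along \<open>q z\<close>; continuity makes \<open>q z\<close> approach
  \<open>q x\<close>, and injectivity keeps the two apart. Working within sets covers one-sided
  derivatives at endpoints.\<close>

lemma has_real_derivative_inverse_within:
  fixes P q :: "real \<Rightarrow> real"
  assumes der: "(P has_real_derivative D) (at (q x) within A)" and "D \<noteq> 0"
    and q: "q ` B \<subseteq> A" "\<And>z. z \<in> B \<Longrightarrow> P (q z) = z"
    and cont: "continuous_on B q" and x: "x \<in> B"
  shows "(q has_real_derivative 1 / D) (at x within B)"
proof -
  have "filterlim q (at (q x) within A) (at x within B)"
    unfolding filterlim_at
  proof (intro conjI)
    show "\<forall>\<^sub>F z in at x within B. q z \<in> A \<and> q z \<noteq> q x"
      unfolding eventually_at_filter
    proof (intro always_eventually allI impI)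
      fix z assume "z \<noteq> x" "z \<in> B"
      then show "q z \<in> A \<and> q z \<noteq> q x" using q(1) q(2)[of z] q(2)[OF x] by auto
    qed
    show "(q \<longlongrightarrow> q x) (at x within B)" using cont x by (simp add: continuous_on)
  qed
  from filterlim_compose[OF der[unfolded has_field_derivative_iff] this]
  have "((\<lambda>z. (P (q z) - P (q x)) / (q z - q x)) \<longlongrightarrow> D) (at x within B)" .
  from tendsto_inverse[OF this \<open>D \<noteq> 0\<close>]
  have "((\<lambda>z. (q z - q x) / (P (q z) - P (q x))) \<longlongrightarrow> 1 / D) (at x within B)"
    by (simp add: inverse_eq_divide)
  moreover have "\<forall>\<^sub>F z in at x within B. (q z - q x) / (P (q z) - P (q x)) = (q z - q x) / (z - x)"
    unfolding eventually_at_filter using q(2) x by (intro always_eventually) simp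
  ultimately show ?thesis
    unfolding has_field_derivative_iff by (rule Lim_transform_eventually)
qed

text \<open>The elapsed time \<open>P x\<close>, the integral of \<open>1 / g\<close> from 0 to
  \<open>x\<close>, increases strictly from \<open>{0..b}\<close> onto \<open>{0..T}\<close>; its
  inverse is the solution.\<close>

lemma separable_ode_solution:
  fixes g :: "real \<Rightarrow> real"
  assumes b: "0 \<le> b" and cont: "continuous_on {0..b} g" and pos: "\<And>u. u \<in> {0..b} \<Longrightarrow> 0 < g u"
    and T: "integral {0..b} (\<lambda>u. 1 / g u) = T"
  obtains p where "p 0 = 0" "p T = b" "p ` {0..T} \<subseteq> {0..b}"
    "\<And>t. t \<in> {0..T} \<Longrightarrow> (p has_real_derivative g (p t)) (at t within {0..T})"
proof -
  define P where "P x = integral {0..x} (\<lambda>u. 1 / g u)" for x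
  have contg: "continuous_on {0..b} (\<lambda>u. 1 / g u)"
    using cont pos by (intro continuous_intros) (auto simp: less_imp_neq[symmetric])
  have der: "(P has_real_derivative 1 / g x) (at x within {0..b})" if "x \<in> {0..b}" for x
    using integral_has_real_derivative[OF contg that] by (simp add: P_def[abs_def])
  have contP: "continuous_on {0..b} P"
    using der DERIV_continuous continuous_on_eq_continuous_within by blast
  have smono: "P x < P y" if "0 \<le> x" "x < y" "y \<le> b" for x y
  proof (rule DERIV_pos_imp_increasing_open[OF \<open>x < y\<close>])
    fix z assume "x < z" "z < y"
    with der[of z] that have "DERIV P z :> 1 / g z" by (simp add: at_within_Icc_at)
    moreover have "1 / g z > 0" using pos[of z] that \<open>x < z\<close> \<open>z < y\<close> by simp
    ultimately show "\<exists>d. DERIV P z :> d \<and> 0 < d" by blast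
  next
    show "continuous_on {x..y} P" by (rule continuous_on_subset[OF contP]) (use that in auto)
  qed
  have inj: "inj_on P {0..b}"
  proof (rule inj_onI)
    fix x y assume "x \<in> {0..b}" "y \<in> {0..b}" "P x = P y"
    then show "x = y" using smono[of x y] smono[of y x] by (cases x y rule: linorder_cases) auto
  qed
  have P0: "P 0 = 0" and PT: "P b = T" by (simp_all add: P_def T)
  have img: "P ` {0..b} = {0..T}"
  proof
    have "P 0 \<le> P x \<and> P x \<le> P b" if "x \<in> {0..b}" for x
      using that smono[of 0 x] smono[of x b] by (cases "x = 0"; cases "x = b") auto
    then show "P ` {0..b} \<subseteq> {0..T}" by (auto simp: P0 PT)
    show "{0..T} \<subseteq> P ` {0..b}"
    proof
      fix t assume "t \<in> {0..T}"
      with IVT'[of P 0 t b] contP b P0 PT obtain x where "0 \<le> x" "x \<le> b" "P x = t" by auto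
      then show "t \<in> P ` {0..b}" by auto
    qed
  qed
  define q where "q = inv_into {0..b} P"
  have qP: "q (P x) = x" if "x \<in> {0..b}" for x
    unfolding q_def using inj that by (rule inv_into_f_f)
  have contq: "continuous_on {0..T} q"
    unfolding img[symmetric] by (rule continuous_on_inv[OF contP]) (use qP in auto)
  have Pq: "P (q t) = t" "q t \<in> {0..b}" if "t \<in> {0..T}" for t
    using that img f_inv_into_f[of t P "{0..b}"] inv_into_into[of t P "{0..b}"] by (auto simp: q_def)
  show thesis
  proof
    show "q 0 = 0" "q T = b" using qP[of 0] qP[of b] P0 PT b by auto
    show "q ` {0..T} \<subseteq> {0..b}" using Pq by auto
    show "(q has_real_derivative g (q t)) (at t within {0..T})" if "t \<in> {0..T}" for t
    proof -
      have "g (q t) > 0" "q ` {0..T} \<subseteq> {0..b}" using pos[OF Pq(2)[OF that]] Pq(2) by auto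
      with has_real_derivative_inverse_within[OF der[OF Pq(2)[OF that]] _ _ Pq(1) contq that]
      show ?thesis by simp
    qed
  qed
qed

section \<open>Parametric integrals and logarithmic divergence\<close>

lemma integral_scaled_interval:
  fixes h :: "real \<Rightarrow> real"
  assumes "0 \<le> c"
  shows "integral {0..c} h = c * integral {0..1} (\<lambda>u. h (c * u))"
proof (cases "c = 0")
  case False
  then have c: "c > 0" using assms by simp
  have "(\<lambda>x. x / c) ` {0..c} = {0..1}"
    using c by (simp add: image_divide_atLeastAtMost)
  with integral_stretch_real[of c 0 c h] c show ?thesis by (simp add: field_simps)
qed simp

text \<open>Rescaling to \<open>{0..1}\<close> moves the variable endpoint into the integrand, where
  the continuity theorem for a fixed interval applies.\<close>

lemma continuous_on_integral_upper:
  fixes h :: "'a::topological_space \<Rightarrow> real \<Rightarrow> real" and c :: "'a \<Rightarrow> real"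
  assumes c: "continuous_on S c" "\<And>x. x \<in> S \<Longrightarrow> 0 \<le> c x"
    and h: "continuous_on (S \<times> {0..1}) (\<lambda>(x, u). h x (c x * u))"
  shows "continuous_on S (\<lambda>x. integral {0..c x} (h x))"
proof -
  have "continuous_on S (\<lambda>x. c x * integral (cbox 0 1) (\<lambda>u. h x (c x * u)))"
    by (intro continuous_intros c integral_continuous_on_param) (use h in simp)
  then show ?thesis
    using c(2) by (subst continuous_on_cong[OF refl integral_scaled_interval]) auto
qed

text \<open>With \<open>e = d^2\<close> the bound on \<open>h\<close> is at most
  \<open>C * (a - u + d)^2\<close>, whose inverse square root integrates to a logarithm. One
  \<open>e\<close> serves all \<open>a\<close> and \<open>h\<close>, so the integrand may vary with
  the orbit.\<close>

lemma integral_inverse_sqrt_diverges: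
  fixes a0 C M :: real
  assumes "0 < a0" "0 < C"
  obtains e where "0 < e"
    "\<And>a h. \<lbrakk>a0 \<le> a; continuous_on {0..a} h;
       \<And>u. u \<in> {0..a} \<Longrightarrow> 0 < h u \<and> h u \<le> C * ((a - u)\<^sup>2 + e)\<rbrakk>
       \<Longrightarrow> M \<le> integral {0..a} (\<lambda>u. 1 / sqrt (h u))"
proof
  \<comment> \<open>Solves \<open>(ln a0 - ln d) / sqrt C = M\<close> for \<open>d\<close>.\<close>
  define d where "d = a0 * exp (- sqrt C * M)"
  have d: "d > 0" using assms by (simp add: d_def)
  show "d\<^sup>2 > 0" using d by simp
  fix a :: real and h :: "real \<Rightarrow> real"
  assume a: "a0 \<le> a" and hc: "continuous_on {0..a} h"
    and h: "\<And>u. u \<in> {0..a} \<Longrightarrow> 0 < h u \<and> h u \<le> C * ((a - u)\<^sup>2 + d\<^sup>2)"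
  have a0: "a > 0" using a assms by simp
  have "((\<lambda>u. 1 / (sqrt C * (a - u + d))) has_integral
      (- ln (a - a + d) / sqrt C - (- ln (a - 0 + d) / sqrt C))) {0..a}"
    by (rule fundamental_theorem_of_calculus)
       (use a0 d assms in \<open>auto intro!: derivative_eq_intros
          simp: has_real_derivative_iff_has_vector_derivative[symmetric] divide_simps\<close>)
  then have I: "((\<lambda>u. 1 / (sqrt C * (a - u + d))) has_integral ((ln (a + d) - ln d) / sqrt C)) {0..a}"
    by (simp add: diff_divide_distrib)
  have "1 / (sqrt C * (a - u + d)) \<le> 1 / sqrt (h u)" if u: "u \<in> {0..a}" for u
  proof -
    have "h u \<le> C * ((a - u)\<^sup>2 + d\<^sup>2)" using h[OF u] by simp
    also have "\<dots> \<le> C * (a - u + d)\<^sup>2"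
      using u d assms by (intro mult_left_mono) (auto simp: power2_sum)
    finally have "sqrt (h u) \<le> sqrt (C * (a - u + d)\<^sup>2)" by simp
    also have "\<dots> = sqrt C * (a - u + d)" using u d by (simp add: real_sqrt_mult)
    finally show ?thesis
      using h[OF u] u d assms by (intro divide_left_mono mult_pos_pos) auto
  qed
  then have "(ln (a + d) - ln d) / sqrt C \<le> integral {0..a} (\<lambda>u. 1 / sqrt (h u))"
    using h hc
    by (intro has_integral_le[OF I integrable_integral] integrable_continuous_real)
       (auto intro!: continuous_intros simp: less_le)
  moreover have "M \<le> (ln (a + d) - ln d) / sqrt C"
  proof -
    have "ln d = ln a0 - sqrt C * M" using assms by (simp add: d_def ln_mult)
    moreover have "ln a0 \<le> ln (a + d)" using a d assms by simp
    ultimately show ?thesis using assms by (simp add: field_simps)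
  qed
  ultimately show "M \<le> integral {0..a} (\<lambda>u. 1 / sqrt (h u))" by simp
qed

section \<open>Calculus with absolute values, limits and suprema\<close>

lemma has_real_derivative_mult_abs:
  "((\<lambda>y::real. y * \<bar>y\<bar>) has_real_derivative 2 * \<bar>y\<bar>) (at y)"
proof -
  consider "y > 0" | "y < 0" | "y = 0" by linarith
  then show ?thesis
  proof cases
    case 1
    have "((\<lambda>y::real. y * y) has_real_derivative 2 * \<bar>y\<bar>) (at y)"
      using 1 by (auto intro!: derivative_eq_intros)
    then show ?thesis
      by (rule has_field_derivative_transform_within_open[of _ _ _ "{0<..}"]) (use 1 in auto)
  next
    case 2
    have "((\<lambda>y::real. y * - y) has_real_derivative 2 * \<bar>y\<bar>) (at y)"
      using 2 by (auto intro!: derivative_eq_intros)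
    then show ?thesis
      by (rule has_field_derivative_transform_within_open[of _ _ _ "{..<0}"]) (use 2 in auto)
  next
    case 3
    have "((\<lambda>h::real. \<bar>h\<bar>) \<longlongrightarrow> 0) (at 0)" by (rule tendsto_eq_intros refl)+ simp
    then have "((\<lambda>h::real. (h * \<bar>h\<bar>) / h) \<longlongrightarrow> 0) (at 0)"
      by (rule Lim_transform_eventually) (simp add: eventually_at_filter)
    with 3 show ?thesis by (simp add: DERIV_def)
  qed
qed

lemmas DERIV_mult_abs [derivative_intros] = DERIV_chain2[OF has_real_derivative_mult_abs]

lemma one_minus_cos_le: "1 - cos x \<le> x\<^sup>2 / 2" for x :: real
proof -
  have "\<bar>sin (x / 2)\<bar>\<^sup>2 \<le> \<bar>x / 2\<bar>\<^sup>2" by (intro power_mono abs_sin_x_le_abs_x) simp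
  moreover have "cos x = 1 - 2 * (sin (x / 2))\<^sup>2" using cos_double_sin[of "x / 2"] by simp
  ultimately show ?thesis by (simp add: power_divide)
qed

text \<open>This is the one term of \<open>R Y \<bar>sin u\<bar>\<close> in which the absolute value
  survives; the factor \<open>s^2\<close> removes the corner at 0.\<close>

lemma has_real_derivative_sq_div_abs:
  "((\<lambda>s::real. s\<^sup>2 / (1 + \<bar>s\<bar>)) has_real_derivative (s * (2 + \<bar>s\<bar>) / (1 + \<bar>s\<bar>)\<^sup>2)) (at s)"
proof -
  consider "s > 0" | "s < 0" | "s = 0" by linarith
  then show ?thesis
  proof cases
    case 1
    have "((\<lambda>s::real. s\<^sup>2 / (1 + s)) has_real_derivative (s * (2 + \<bar>s\<bar>) / (1 + \<bar>s\<bar>)\<^sup>2)) (at s)"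
      using 1 by (auto intro!: derivative_eq_intros simp: power2_eq_square field_simps)
    then show ?thesis
      by (rule has_field_derivative_transform_within_open[of _ _ _ "{0<..}"]) (use 1 in auto)
  next
    case 2
    have "((\<lambda>s::real. s\<^sup>2 / (1 - s)) has_real_derivative (s * (2 + \<bar>s\<bar>) / (1 + \<bar>s\<bar>)\<^sup>2)) (at s)"
      using 2 by (auto intro!: derivative_eq_intros simp: power2_eq_square field_simps)
    then show ?thesis
      by (rule has_field_derivative_transform_within_open[of _ _ _ "{..<0}"]) (use 2 in auto)
  next
    case 3
    have "((\<lambda>h::real. h / (1 + \<bar>h\<bar>)) \<longlongrightarrow> 0) (at 0)" by (rule tendsto_eq_intros refl)+ simp_all
    then have "((\<lambda>h::real. (h\<^sup>2 / (1 + \<bar>h\<bar>)) / h) \<longlongrightarrow> 0) (at 0)"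
      by (rule Lim_transform_eventually) (simp add: eventually_at_filter power2_eq_square)
    with 3 show ?thesis by (simp add: DERIV_def)
  qed
qed

text \<open>An increasing function bounded below tends to its infimum. The filter is the one used in
  \<open>Tk0\<close>.\<close>

lemma tendsto_strict_mono_at_0:
  fixes f :: "real \<Rightarrow> real"
  assumes "0 < c" and mono: "\<And>x y. \<lbrakk>0 < x; x < y; y < c\<rbrakk> \<Longrightarrow> f x < f y"
    and bdd: "\<And>x. \<lbrakk>0 < x; x < c\<rbrakk> \<Longrightarrow> B \<le> f x"
  shows "(f \<longlongrightarrow> Inf (f ` {0<..<c})) (at 0 within {0<..<c})"
proof (rule order_tendstoI)
  let ?I = "Inf (f ` {0<..<c})"
  have bd: "bdd_below (f ` {0<..<c})" using bdd by (auto intro!: bdd_belowI)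
  fix a
  show "\<forall>\<^sub>F x in at 0 within {0<..<c}. a < f x" if "a < ?I"
    unfolding eventually_at_filter
  proof (intro always_eventually allI impI)
    fix x assume "x \<in> {0<..<c}"
    then have "?I \<le> f x" by (intro cInf_lower bd) auto
    with that show "a < f x" by simp
  qed
  assume "?I < a"
  then obtain x where x: "0 < x" "x < c" "f x < a"
    using cInf_less_iff[OF _ bd, of a] \<open>0 < c\<close> by auto
  have "\<forall>\<^sub>F z in at 0 within {0<..<c}. z < x"
    using x unfolding eventually_at by (intro exI[of _ x]) (auto simp: dist_real_def)
  moreover have "\<forall>\<^sub>F z in at 0 within {0<..<c}. 0 < z"
    unfolding eventually_at_filter by (intro always_eventually) auto
  ultimately show "\<forall>\<^sub>F z in at 0 within {0<..<c}. f z < a"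
    by eventually_elim (use x mono less_trans in blast)
qed

text \<open>For \<open>K = 0\<close> the index set is empty and the bottom element of
  \<open>enat\<close> is 0, as the convention of the theorem demands.\<close>

lemma SUP_enat_atLeastAtMost: "(SUP k\<in>{1..K}. enat k) = enat K"
proof (cases K)
  case 0
  then show ?thesis by (simp add: bot_enat_def zero_enat_def)
next
  case (Suc n)
  then show ?thesis by (intro antisym SUP_least SUP_upper) auto
qed

subsection \<open>Geometry of the phase plane\<close>

locale mfg =
  fixes \<eta> :: real
  assumes \<eta>_nonneg: "0 \<le> \<eta>" and \<eta>_less: "\<eta> < 1/2"
begin

definition F :: "real \<Rightarrow> real" where "F y = 1/2 * (y * \<bar>y\<bar>) + 2 * \<eta> * y"

definition force :: "real \<Rightarrow> real" where
  "force y = 1/2 * y^3 + 3 * \<eta> * (y * \<bar>y\<bar>) + 4 * \<eta>\<^sup>2 * y - y"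

definition ys :: real where "ys = sqrt (\<eta>\<^sup>2 + 2) - 3 * \<eta>"
definition xs :: real where "xs = 1 - \<eta>\<^sup>2 - \<eta> * sqrt (\<eta>\<^sup>2 + 2)"

lemma ys_pos: "0 < ys"
proof -
  have "(3 * \<eta>)\<^sup>2 < \<eta>\<^sup>2 + 2"
    using \<eta>_nonneg \<eta>_less mult_strict_mono[of \<eta> "1/2" \<eta> "1/2"] by (simp add: power2_eq_square)
  then have "3 * \<eta> < sqrt (\<eta>\<^sup>2 + 2)" by (rule real_less_rsqrt)
  then show ?thesis by (simp add: ys_def)
qed

lemma ys_quadratic: "ys\<^sup>2 + 6 * \<eta> * ys + 8 * \<eta>\<^sup>2 = 2"
proof -
  have "(ys + 3 * \<eta>)\<^sup>2 = \<eta>\<^sup>2 + 2" by (simp add: ys_def)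
  then show ?thesis by (simp add: power2_eq_square algebra_simps)
qed

lemma F_nonneg_eq: "0 \<le> y \<Longrightarrow> F y = 1/2 * y\<^sup>2 + 2 * \<eta> * y"
  by (simp add: F_def power2_eq_square)

lemma F_minus [simp]: "F (- y) = - F y"
  by (simp add: F_def)

lemma F_0 [simp]: "F 0 = 0"
  by (simp add: F_def)

lemma F_ys: "F ys = xs"
proof -
  have s: "sqrt (\<eta>\<^sup>2 + 2) = ys + 3 * \<eta>" by (simp add: ys_def)
  show ?thesis
    unfolding xs_def s F_nonneg_eq[OF less_imp_le[OF ys_pos]]
    using ys_quadratic by (simp add: power2_eq_square algebra_simps)
qed

lemma F_strict_mono: "x < y \<Longrightarrow> F x < F y"
proof -
  assume "x < y"
  moreover have "x * \<bar>x\<bar> < y * \<bar>y\<bar>"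
  proof -
    consider "0 \<le> x" | "y \<le> 0" | "x < 0" "0 < y" by linarith
    then show ?thesis
    proof cases
      case 1 then show ?thesis using \<open>x < y\<close> by (auto intro: mult_strict_mono)
    next
      case 2 then show ?thesis
        using \<open>x < y\<close> mult_strict_mono[of "- y" "- x" "- y" "- x"] by simp
    next
      case 3
      then have "x * \<bar>x\<bar> < 0" "0 < y * \<bar>y\<bar>"
        by (auto simp: mult_less_0_iff zero_less_mult_iff)
      then show ?thesis by linarith
    qed
  qed
  ultimately show ?thesis
    using \<eta>_nonneg by (simp add: F_def mult_left_mono add_less_le_mono)
qed

lemma F_mono: "x \<le> y \<Longrightarrow> F x \<le> F y"
  using F_strict_mono[of x y] by (cases "x = y") auto

lemma xs_pos: "0 < xs"
  using F_strict_mono[OF ys_pos] by (simp add: F_ys)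

text \<open>The first-order system reads \<open>x' = x * (\<bar>y\<bar> + 2 * \<eta>) - y\<close>
  and \<open>y' = x - F y\<close>. This is stationarity of \<open>x\<close> at the saddle, while
  \<open>F_ys\<close> is that of \<open>y\<close>.\<close>

lemma xs_saddle: "xs * (ys + 2 * \<eta>) = ys"
proof -
  have "ys * (ys\<^sup>2 + 6 * \<eta> * ys + 8 * \<eta>\<^sup>2) = ys * 2" by (simp add: ys_quadratic)
  then show ?thesis
    using ys_pos by (simp add: F_ys[symmetric] F_nonneg_eq power2_eq_square field_simps)
qed

lemma xs_le_1: "xs \<le> 1"
proof -
  have "0 \<le> \<eta> * sqrt (\<eta>\<^sup>2 + 2)" using \<eta>_nonneg by (intro mult_nonneg_nonneg) auto
  then show ?thesis using zero_le_power2[of \<eta>] unfolding xs_def by linarith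
qed

lemma xs_less_1:
  assumes "0 < \<eta>"
  shows "xs < 1"
proof -
  have "0 \<le> \<eta> * sqrt (\<eta>\<^sup>2 + 2)" using assms by (intro mult_nonneg_nonneg) auto
  moreover have "0 < \<eta>\<^sup>2" using assms by simp
  ultimately show ?thesis unfolding xs_def by linarith
qed

lemma G_eq: "G \<eta> y = (F y)\<^sup>2 - y\<^sup>2"
proof (cases "y \<ge> 0")
  case True
  then show ?thesis by (simp add: G_def F_def power2_eq_square power3_eq_cube power4_eq_xxxx algebra_simps)
next
  case False
  then show ?thesis by (simp add: G_def F_def power2_eq_square power3_eq_cube power4_eq_xxxx algebra_simps)
qed

lemma G_minus [simp]: "G \<eta> (- y) = G \<eta> y"
  by (simp add: G_eq)

lemma G_abs [simp]: "G \<eta> \<bar>y\<bar> = G \<eta> y"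
  by (simp add: abs_if)

lemma G_0 [simp]: "G \<eta> 0 = 0"
  by (simp add: G_eq)

lemma DERIV_F: "(F has_real_derivative \<bar>y\<bar> + 2 * \<eta>) (at y)"
  unfolding F_def by (auto intro!: derivative_eq_intros)

lemma DERIV_G: "(G \<eta> has_real_derivative 2 * force y) (at y)"
proof -
  have "(\<lambda>y. G \<eta> y) = (\<lambda>y. (F y)\<^sup>2 - y\<^sup>2)" by (simp add: G_eq)
  moreover have "((\<lambda>y. (F y)\<^sup>2 - y\<^sup>2) has_real_derivative 2 * force y) (at y)"
    by (rule derivative_eq_intros DERIV_F refl)+
       (cases "y \<ge> 0"; simp add: F_def force_def power2_eq_square power3_eq_cube field_simps)
  ultimately show ?thesis by simp
qed

lemma continuous_on_F [continuous_intros]: "continuous_on S f \<Longrightarrow> continuous_on S (\<lambda>x. F (f x))"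
  unfolding F_def by (intro continuous_intros)

lemma continuous_on_G [continuous_intros]: "continuous_on S f \<Longrightarrow> continuous_on S (\<lambda>x. G \<eta> (f x))"
  unfolding G_def by (intro continuous_intros)

text \<open>The force vanishes at \<open>ys\<close>, so \<open>ys\<close> is a double zero of
  \<open>G \<eta> y - G \<eta> ys\<close>. The cofactor has nonnegative coefficients, which makes
  \<open>ys\<close> a minimum and later controls travel times near the saddle.\<close>

lemma G_expand_saddle:
  assumes "0 \<le> y"
  shows "G \<eta> y = G \<eta> ys + (y - ys)\<^sup>2 * (y\<^sup>2 / 4 + (2 * \<eta> + ys / 2) * y + \<eta> * ys + ys\<^sup>2 / 4)"
proof -
  define p where "p = ys"
  have q: "p^2 + 6 * \<eta> * p + 8 * \<eta>^2 = 2" and p: "0 \<le> p"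
    using ys_quadratic ys_pos by (simp_all add: p_def)
  have "G \<eta> z = z^4/4 + 2 * \<eta> * z^3 - (p^2/2 + 3 * \<eta> * p) * z^2" if "0 \<le> z" for z
  proof -
    \<comment> \<open>The quadratic equation for \<open>ys\<close> replaces the coefficient
      \<open>4 * \<eta>^2 - 1\<close>, so that a polynomial identity remains.\<close>
    have "p^2/2 + 3 * \<eta> * p = 1 - 4 * \<eta>^2" using q by simp
    then show ?thesis using that by (simp only:) (simp add: G_def algebra_simps)
  qed
  from this[OF assms] this[OF p] show ?thesis
    unfolding p_def[symmetric]
    by (simp add: power2_eq_square power3_eq_cube power4_eq_xxxx field_simps)
qed

lemma G_ge_saddle: "G \<eta> ys \<le> G \<eta> y"
proof -
  have "G \<eta> ys \<le> G \<eta> \<bar>y\<bar>"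
    using \<eta>_nonneg ys_pos by (subst G_expand_saddle) (auto intro!: mult_nonneg_nonneg add_nonneg_nonneg)
  then show ?thesis by simp
qed

lemma G_eq_saddle_iff: "0 \<le> y \<Longrightarrow> G \<eta> y = G \<eta> ys \<longleftrightarrow> y = ys"
proof -
  assume "0 \<le> y"
  then have "y\<^sup>2 / 4 + (2 * \<eta> + ys / 2) * y + \<eta> * ys + ys\<^sup>2 / 4 > 0"
    using \<eta>_nonneg ys_pos by (intro add_nonneg_pos) auto
  then show ?thesis using G_expand_saddle[OF \<open>0 \<le> y\<close>] by auto
qed

lemma force_factor: "0 \<le> y \<Longrightarrow> 2 * force y = y * (y - ys) * (y + ys + 6 * \<eta>)"
proof -
  assume "0 \<le> y"
  then have "2 * force y = y * (y\<^sup>2 + 6 * \<eta> * y + 8 * \<eta>\<^sup>2 - 2)"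
    by (simp add: force_def power2_eq_square power3_eq_cube algebra_simps)
  also have "\<dots> = y * (y\<^sup>2 + 6 * \<eta> * y - ys\<^sup>2 - 6 * \<eta> * ys)"
    by (subst ys_quadratic[symmetric]) (simp add: algebra_simps)
  finally show ?thesis by (simp add: power2_eq_square algebra_simps)
qed

lemma force_ys: "force ys = 0"
  using force_factor[of ys] ys_pos by simp

lemma G_strict_decreasing:
  assumes "0 \<le> a" "a < b" "b \<le> ys"
  shows "G \<eta> b < G \<eta> a"
proof (rule DERIV_neg_imp_decreasing_open[OF \<open>a < b\<close>])
  fix z assume z: "a < z" "z < b"
  have "z * (z - ys) * (z + ys + 6 * \<eta>) < 0"
    using z assms \<eta>_nonneg ys_pos by (intro mult_neg_pos mult_pos_neg) auto
  then show "\<exists>d. DERIV (G \<eta>) z :> d \<and> d < 0"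
    using DERIV_G[of z] force_factor[of z] z assms by (intro exI[of _ "2 * force z"]) auto
qed (intro continuous_intros)

lemma v0_eq: "v0 \<eta> = sqrt (- G \<eta> ys)"
  by (simp add: v0_def ys_def)

lemma v0_pos: "0 < v0 \<eta>" and v0_sq: "(v0 \<eta>)\<^sup>2 = - G \<eta> ys"
  using G_strict_decreasing[of 0 ys] ys_pos by (auto simp: v0_eq)

text \<open>The squared initial velocity of the orbit through the point \<open>(x, y)\<close>, for \<open>0 \<le> y\<close>.\<close>

definition level :: "real \<Rightarrow> real \<Rightarrow> real" where
  "level x y = x\<^sup>2 + (1 - x) * y\<^sup>2 - 4 * \<eta> * x * y"

text \<open>On an orbit \<open>x - F y\<close> is the velocity, so by the energy identity the right
  side is the squared initial velocity.\<close>

lemma level_eq: "0 \<le> y \<Longrightarrow> level x y = (x - F y)\<^sup>2 - G \<eta> y"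
  by (simp add: level_def G_eq F_nonneg_eq power2_eq_square algebra_simps)

text \<open>Completing the square: by \<open>xs_saddle\<close> the linear term places the vertex at
  \<open>ys\<close>, where the value is \<open>- G \<eta> ys\<close>.\<close>

lemma level_xs: "level xs y = (v0 \<eta>)\<^sup>2 + (1 - xs) * (y - ys)\<^sup>2"
proof -
  have a: "(1 - xs) * ys = 2 * \<eta> * xs" using xs_saddle by (simp add: algebra_simps)
  have b: "level xs ys = (v0 \<eta>)\<^sup>2" using ys_pos by (simp add: level_eq v0_sq F_ys)
  have "level xs y = xs\<^sup>2 + (1 - xs) * y\<^sup>2 - 2 * ((1 - xs) * ys) * y"
    unfolding a by (simp add: level_def)
  moreover have "level xs ys = xs\<^sup>2 + (1 - xs) * ys\<^sup>2 - 2 * ((1 - xs) * ys) * ys"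
    unfolding a by (simp add: level_def)
  ultimately show ?thesis unfolding b[symmetric] by (simp add: power2_eq_square algebra_simps)
qed

text \<open>On \<open>{0..ys}\<close> the velocity \<open>x - F y\<close> is nonnegative at
  \<open>x = xs\<close> and grows with \<open>x\<close>.\<close>

lemma level_mono:
  assumes "xs \<le> x" "0 \<le> y" "y \<le> ys"
  shows "level xs y \<le> level x y"
proof -
  have "F y \<le> xs" using F_mono[OF assms(3)] by (simp add: F_ys)
  then have "(xs - F y)\<^sup>2 \<le> (x - F y)\<^sup>2" using assms by (intro power_mono) auto
  then show ?thesis using assms by (simp add: level_eq)
qed

text \<open>The inequality says that \<open>x' \<ge> 0\<close> in the first-order system. Up to
  \<open>ys\<close> it is inherited from the saddle identity because \<open>xs \<le> 1\<close>;
  beyond \<open>ys\<close> it follows from a nonnegative force and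
  \<open>F y \<le> x\<close>.\<close>

lemma nullcline_bound:
  assumes "xs \<le> x" "0 \<le> y" "F y \<le> x"
  shows "y \<le> x * (y + 2 * \<eta>)"
proof (cases "y \<le> ys")
  case True
  have "(1 - xs) * y \<le> (1 - xs) * ys" using True xs_le_1 by (intro mult_left_mono) auto
  then have "y \<le> xs * (y + 2 * \<eta>)" using xs_saddle by (simp add: algebra_simps)
  also have "\<dots> \<le> x * (y + 2 * \<eta>)" using assms \<eta>_nonneg by (intro mult_right_mono) auto
  finally show ?thesis .
next
  case False
  then have "0 \<le> y * (y - ys) * (y + ys + 6 * \<eta>)"
    using assms \<eta>_nonneg ys_pos by (intro mult_nonneg_nonneg) auto
  then have "0 \<le> force y" using force_factor[of y] assms by simp
  moreover have "force y = F y * (y + 2 * \<eta>) - y"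
    using assms by (simp add: force_def F_def power2_eq_square power3_eq_cube algebra_simps)
  ultimately have "y \<le> F y * (y + 2 * \<eta>)" by simp
  also have "\<dots> \<le> x * (y + 2 * \<eta>)" using assms \<eta>_nonneg by (intro mult_right_mono) auto
  finally show ?thesis .
qed

text \<open>The chord slope of the quadratic is \<open>(1 - x) * (a + b) - 4 * \<eta> * x\<close>;
  adding \<open>nullcline_bound\<close> at \<open>a\<close> and at \<open>b\<close> makes it at most
  0.\<close>

lemma level_antimono:
  assumes "xs \<le> x" "x \<le> 1" "0 \<le> a" "a \<le> b" "F b \<le> x"
  shows "level x b \<le> level x a"
proof -
  have "a \<le> x * (a + 2 * \<eta>)" "b \<le> x * (b + 2 * \<eta>)"
    using nullcline_bound[of x a] nullcline_bound[of x b] F_mono[of a b] assms by auto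
  then have "(b - a) * ((1 - x) * (a + b) - 4 * \<eta> * x) \<le> 0"
    using assms by (intro mult_nonneg_nonpos) (auto simp: algebra_simps)
  then show ?thesis by (simp add: level_def power2_eq_square algebra_simps)
qed

subsection \<open>The second-order equation\<close>

definition ode :: "real \<Rightarrow> (real \<Rightarrow> real) \<Rightarrow> (real \<Rightarrow> real) \<Rightarrow> bool" where
  "ode T y y' \<longleftrightarrow> (\<forall>t\<in>{0..T}. (y has_real_derivative y' t) (at t within {0..T}) \<and>
     (y' has_real_derivative force (y t)) (at t within {0..T}))"

lemma odeD:
  assumes "ode T y y'" "t \<in> {0..T}"
  shows "(y has_real_derivative y' t) (at t within {0..T})"
    and "(y' has_real_derivative force (y t)) (at t within {0..T})"
  using assms by (auto simp: ode_def)

lemma ode_continuous: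
  assumes "ode T y y'"
  shows "continuous_on {0..T} y" "continuous_on {0..T} y'"
  using odeD[OF assms] DERIV_continuous continuous_on_eq_continuous_within by blast+

lemma ode_minus: "ode T y y' \<Longrightarrow> ode T (\<lambda>t. - y t) (\<lambda>t. - y' t)"
  unfolding ode_def force_def by (auto intro!: derivative_eq_intros)

lemma ode_energy:
  assumes "ode T y y'" "y 0 = 0" "t \<in> {0..T}"
  shows "(y' t)\<^sup>2 = G \<eta> (y t) + (y' 0)\<^sup>2"
proof -
  have "((\<lambda>t. (y' t)\<^sup>2 - G \<eta> (y t)) has_real_derivative 0) (at x within {0..T})" if "x \<in> {0..T}" for x
    using odeD[OF assms(1) that]
    by (auto intro!: derivative_eq_intros DERIV_chain2[OF DERIV_G])
  from has_field_derivative_zero_constant[OF convex_real_interval(5) this]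
  obtain c where "\<And>x. x \<in> {0..T} \<Longrightarrow> (y' x)\<^sup>2 - G \<eta> (y x) = c" by blast
  from this[of t] this[of 0] assms show ?thesis by auto
qed

lemma force_lipschitz:
  assumes "\<bar>a\<bar> \<le> M" "\<bar>b\<bar> \<le> M"
  shows "\<bar>force a - force b\<bar> \<le> (3/2 * M\<^sup>2 + 6 * \<eta> * M + 4 * \<eta>\<^sup>2 + 1) * \<bar>a - b\<bar>"
proof -
  let ?f = "\<lambda>y. 3/2 * y\<^sup>2 + 6 * \<eta> * \<bar>y\<bar> + 4 * \<eta>\<^sup>2 - 1"
  have "norm (force a - force b) \<le> (3/2 * M\<^sup>2 + 6 * \<eta> * M + 4 * \<eta>\<^sup>2 + 1) * norm (a - b)"
  proof (rule field_differentiable_bound[of "{-M..M}" force ?f])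
    fix z assume z: "z \<in> {-M..M}"
    show "(force has_real_derivative ?f z) (at z within {-M..M})"
      unfolding force_def by (auto intro!: derivative_eq_intros simp: power2_eq_square)
    have "z\<^sup>2 \<le> M\<^sup>2" using z by (intro power2_le_iff_abs_le[THEN iffD2]) auto
    moreover have "\<eta> * \<bar>z\<bar> \<le> \<eta> * M" using z \<eta>_nonneg by (intro mult_left_mono) auto
    moreover have "0 \<le> \<eta> * \<bar>z\<bar>" "0 \<le> \<eta>\<^sup>2" "0 \<le> z\<^sup>2" using \<eta>_nonneg by auto
    ultimately show "norm (?f z) \<le> 3/2 * M\<^sup>2 + 6 * \<eta> * M + 4 * \<eta>\<^sup>2 + 1"
      unfolding real_norm_def by (intro abs_leI) linarith+
  qed (use assms in auto)
  then show ?thesis by simp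
qed

text \<open>Gronwall argument for the squared distance \<open>E\<close> in the phase plane.
  Agreement at \<open>a\<close> is propagated in both time directions; the backward one rules out
  orbits that arrive at a saddle in finite time.\<close>

lemma ode_unique:
  assumes o1: "ode T y y'" and o2: "ode T z z'"
    and a: "a \<in> {0..T}" "y a = z a" "y' a = z' a" and t: "t \<in> {0..T}"
  shows "y t = z t" "y' t = z' t"
proof -
  obtain M where M: "\<And>t. t \<in> {0..T} \<Longrightarrow> \<bar>y t\<bar> \<le> M \<and> \<bar>z t\<bar> \<le> M"
  proof -
    have "bounded (y ` {0..T})" "bounded (z ` {0..T})"
      using ode_continuous(1)[OF o1] ode_continuous(1)[OF o2]
      by (auto intro!: compact_imp_bounded compact_continuous_image)
    then obtain B C where "\<forall>t\<in>{0..T}. \<bar>y t\<bar> \<le> B" "\<forall>t\<in>{0..T}. \<bar>z t\<bar> \<le> C"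
      by (auto simp: bounded_iff)
    then show ?thesis by (intro that[of "max B C"]) (force simp: le_max_iff_disj)
  qed
  define L where "L = 3/2 * M\<^sup>2 + 6 * \<eta> * M + 4 * \<eta>\<^sup>2 + 1"
  have lip: "\<bar>force (y t) - force (z t)\<bar> \<le> L * \<bar>y t - z t\<bar>" if "t \<in> {0..T}" for t
    using force_lipschitz[of "y t" M "z t"] M[OF that] by (simp add: L_def)
  define E where "E t = (y t - z t)\<^sup>2 + (y' t - z' t)\<^sup>2" for t
  define E' where "E' t = 2 * (y t - z t) * (y' t - z' t)
      + 2 * (y' t - z' t) * (force (y t) - force (z t))" for t
  have dE: "(E has_real_derivative E' t) (at t within {0..T})" if "t \<in> {0..T}" for t
    unfolding E_def E'_def
    using odeD[OF o1 that] odeD[OF o2 that] by (auto intro!: derivative_eq_intros simp: algebra_simps)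
  have bE: "\<bar>E' t\<bar> \<le> (1 + L) * E t" if "t \<in> {0..T}" for t
  proof -
    define u v where "u = \<bar>y t - z t\<bar>" and "v = \<bar>y' t - z' t\<bar>"
    \<comment> \<open>The mixed product is absorbed by the sum of squares, which bounds the
      derivative of \<open>E\<close> by a multiple of \<open>E\<close> itself.\<close>
    have uv: "2 * (u * v) \<le> E t"
      using sum_squares_bound[of u v] by (simp add: u_def v_def E_def algebra_simps)
    have L: "L \<ge> 0" using M[OF that] \<eta>_nonneg by (auto simp: L_def intro!: add_nonneg_nonneg)
    have "\<bar>E' t\<bar> \<le> 2 * (u * v) + 2 * (v * \<bar>force (y t) - force (z t)\<bar>)"
    proof -
      have "E' t = 2 * ((y t - z t) * (y' t - z' t) + (y' t - z' t) * (force (y t) - force (z t)))"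
        by (simp add: E'_def algebra_simps)
      then have "\<bar>E' t\<bar> = 2 * \<bar>(y t - z t) * (y' t - z' t) + (y' t - z' t) * (force (y t) - force (z t))\<bar>"
        by (simp only: abs_mult abs_numeral)
      also have "\<dots> \<le> 2 * (\<bar>(y t - z t) * (y' t - z' t)\<bar> + \<bar>(y' t - z' t) * (force (y t) - force (z t))\<bar>)"
        by (intro mult_left_mono abs_triangle_ineq) simp
      finally show ?thesis by (simp add: u_def v_def abs_mult)
    qed
    also have "\<dots> \<le> 2 * (u * v) + 2 * (v * (L * u))"
      using lip[OF that] by (intro add_left_mono mult_left_mono) (auto simp: u_def v_def)
    also have "\<dots> = (1 + L) * (2 * (u * v))" by (simp add: algebra_simps)
    also have "\<dots> \<le> (1 + L) * E t" using uv L by (intro mult_left_mono) auto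
    finally show ?thesis .
  qed
  have E0: "E t \<ge> 0" "E a = 0" for t using a by (auto simp: E_def)
  have "E t \<le> 0"
  proof (cases "a \<le> t")
    case True
    \<comment> \<open>The exponential weight turns the differential inequality into monotonicity,
      and \<open>E a = 0\<close>.\<close>
    have "E t * exp (- (1 + L) * t) \<le> E a * exp (- (1 + L) * a)"
    proof (rule DERIV_nonpos_imp_decreasing_open[OF True])
      fix x assume "a < x" "x < t"
      then have x: "x \<in> {0..T}" "at x within {0..T} = at x"
        using a t by (auto simp: at_within_Icc_at)
      have "((\<lambda>t. E t * exp (- (1 + L) * t)) has_real_derivative
          (E' x - (1 + L) * E x) * exp (- (1 + L) * x)) (at x)"
        using dE[OF x(1)] unfolding x(2) by (auto intro!: derivative_eq_intros simp: algebra_simps)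
      moreover have "(E' x - (1 + L) * E x) * exp (- (1 + L) * x) \<le> 0"
        using bE[OF x(1)] by (intro mult_nonpos_nonneg) auto
      ultimately show "\<exists>d. ((\<lambda>t. E t * exp (- (1 + L) * t)) has_real_derivative d) (at x) \<and> d \<le> 0"
        by blast
    next
      have "continuous_on {0..T} E" using dE DERIV_continuous continuous_on_eq_continuous_within by blast
      then show "continuous_on {a..t} (\<lambda>t. E t * exp (- (1 + L) * t))"
        using a t by (auto intro!: continuous_intros elim: continuous_on_subset)
    qed
    then show ?thesis using E0 by (simp add: mult_le_0_iff)
  next
    case False
    then have "t \<le> a" by simp
    have "E t * exp ((1 + L) * t) \<le> E a * exp ((1 + L) * a)"
    proof (rule DERIV_nonneg_imp_increasing_open[OF \<open>t \<le> a\<close>])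
      fix x assume "t < x" "x < a"
      then have x: "x \<in> {0..T}" "at x within {0..T} = at x"
        using a t by (auto simp: at_within_Icc_at)
      have "((\<lambda>t. E t * exp ((1 + L) * t)) has_real_derivative
          (E' x + (1 + L) * E x) * exp ((1 + L) * x)) (at x)"
        using dE[OF x(1)] unfolding x(2) by (auto intro!: derivative_eq_intros simp: algebra_simps)
      moreover have "(E' x + (1 + L) * E x) * exp ((1 + L) * x) \<ge> 0"
        using bE[OF x(1)] by (intro mult_nonneg_nonneg) auto
      ultimately show "\<exists>d. ((\<lambda>t. E t * exp ((1 + L) * t)) has_real_derivative d) (at x) \<and> d \<ge> 0"
        by blast
    next
      have "continuous_on {0..T} E" using dE DERIV_continuous continuous_on_eq_continuous_within by blast
      then show "continuous_on {t..a} (\<lambda>t. E t * exp ((1 + L) * t))"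
        using a t by (auto intro!: continuous_intros elim: continuous_on_subset)
    qed
    then show ?thesis using E0 by (simp add: mult_le_0_iff)
  qed
  with E0(1)[of t] have "(y t - z t)\<^sup>2 + (y' t - z' t)\<^sup>2 = 0" unfolding E_def by linarith
  then show "y t = z t" "y' t = z' t" by (simp_all add: sum_power2_eq_zero_iff)
qed

section \<open>Reduction to initial velocities\<close>

definition velocities :: "real \<Rightarrow> real \<Rightarrow> real set" where
  "velocities T x = {s. \<exists>y y'. ode T y y' \<and> y 0 = 0 \<and> y' 0 = s \<and> y' T + F (y T) = x}"

text \<open>\<open>force\<close> and \<open>F\<close> are odd, so \<open>- y\<close> is an orbit
  with the opposite end value. Nonnegative end values therefore suffice.\<close>

lemma velocities_minus: "velocities T (- x) = uminus ` velocities T x"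
proof -
  have "- s \<in> velocities T (- x)" if "s \<in> velocities T x" for s x
  proof -
    from that obtain y y' where y: "ode T y y'" "y 0 = 0" "y' 0 = s" "y' T + F (y T) = x"
      by (auto simp: velocities_def)
    then show ?thesis
      unfolding velocities_def using ode_minus[OF y(1)]
      by (intro CollectI exI[of _ "\<lambda>t. - y t"] exI[of _ "\<lambda>t. - y' t"]) auto
  qed
  from this this[of _ "- x"] show ?thesis by (force simp: image_iff)
qed

lemma solves_P_iff:
  "solves_P \<eta> T \<theta> y \<longleftrightarrow> (\<exists>y'. ode T y y' \<and> y 0 = 0 \<and> y' T + F (y T) = 2 * \<theta> - 1)" (is "?L \<longleftrightarrow> ?R")
proof
  assume ?L
  then obtain y' y'' where y:
      "\<And>t. t \<in> {0..T} \<Longrightarrow> (y has_real_derivative y' t) (at t within {0..T})"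
      "\<And>t. t \<in> {0..T} \<Longrightarrow> (y' has_real_derivative y'' t) (at t within {0..T})"
      "\<And>t. t \<in> {0..T} \<Longrightarrow> y'' t + y t - 1/2 * (y t)^3 - 3 * \<eta> * \<bar>y t\<bar> * y t - 4 * \<eta>^2 * y t = 0"
      "1/2 * y T * \<bar>y T\<bar> + 2 * \<eta> * y T + y' T = 2 * \<theta> - 1" "y 0 = 0"
    unfolding solves_P_def by blast
  have "y'' t = force (y t)" if "t \<in> {0..T}" for t
    using y(3)[OF that] by (simp add: force_def algebra_simps)
  with y(1,2) have "ode T y y'" by (simp add: ode_def)
  with y(4,5) show ?R by (intro exI[of _ y']) (auto simp: F_def algebra_simps)
next
  assume ?R
  then obtain y' where y: "ode T y y'" "y 0 = 0" "y' T + F (y T) = 2 * \<theta> - 1" by blast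
  then show ?L
    unfolding solves_P_def
    by (intro exI[of _ y'] exI[of _ "\<lambda>t. force (y t)"]) (auto simp: ode_def force_def F_def algebra_simps)
qed

text \<open>Injectivity is uniqueness for the initial value problem; for surjectivity an orbit is
  restricted to \<open>{0..T}\<close>, which makes it extensional.\<close>

lemma bij_solutions_velocities:
  assumes T: "0 < T"
  shows "\<exists>f. bij_betw f (solutions_P \<eta> T \<theta>) (velocities T (2 * \<theta> - 1))"
proof -
  define P where "P y y' \<longleftrightarrow> ode T y y' \<and> y 0 = 0 \<and> y' T + F (y T) = 2 * \<theta> - 1" for y y'
  \<comment> \<open>\<open>solves_P\<close> hides the derivative behind an existential quantifier,
    so one is chosen.\<close>
  define D where "D y = (SOME y'. P y y')" for y
  have D: "P y (D y)" if "y \<in> solutions_P \<eta> T \<theta>" for y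
    unfolding D_def using that by (intro someI_ex[of "P y"]) (simp add: solutions_P_def solves_P_iff P_def)
  have "bij_betw (\<lambda>y. D y 0) (solutions_P \<eta> T \<theta>) (velocities T (2 * \<theta> - 1))"
    unfolding bij_betw_def
  proof
    show "inj_on (\<lambda>y. D y 0) (solutions_P \<eta> T \<theta>)"
    proof (rule inj_onI)
      fix y z assume yz: "y \<in> solutions_P \<eta> T \<theta>" "z \<in> solutions_P \<eta> T \<theta>" "D y 0 = D z 0"
      have "y t = z t" if "t \<in> {0..T}" for t
        using ode_unique(1)[of T y "D y" z "D z" 0 t] D[OF yz(1)] D[OF yz(2)] yz(3) T that
        by (simp add: P_def)
      then show "y = z" using yz(1,2) by (intro extensionalityI[of _ "{0..T}"]) (auto simp: solutions_P_def)
    qed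
    show "(\<lambda>y. D y 0) ` solutions_P \<eta> T \<theta> = velocities T (2 * \<theta> - 1)"
    proof (intro equalityI subsetI)
      fix s assume "s \<in> (\<lambda>y. D y 0) ` solutions_P \<eta> T \<theta>"
      then show "s \<in> velocities T (2 * \<theta> - 1)" using D by (auto simp: P_def velocities_def)
    next
      fix s assume "s \<in> velocities T (2 * \<theta> - 1)"
      then obtain y y' where y: "P y y'" "y' 0 = s" by (auto simp: velocities_def P_def)
      define z where "z = restrict y {0..T}"
      have "ode T z y'"
        unfolding ode_def
      proof (intro ballI conjI)
        fix t assume t: "t \<in> {0..T}"
        have o: "ode T y y'" using y by (simp add: P_def)
        show "(z has_real_derivative y' t) (at t within {0..T})"
          by (rule has_field_derivative_transform_within[OF odeD(1)[OF o t] zero_less_one t]) (simp add: z_def)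
        show "(y' has_real_derivative force (z t)) (at t within {0..T})"
          using odeD(2)[OF o t] t by (simp add: z_def)
      qed
      then have z: "P z y'" using y T by (auto simp: P_def z_def)
      then have zs: "z \<in> solutions_P \<eta> T \<theta>"
        unfolding solutions_P_def solves_P_iff by (auto simp: P_def z_def)
      \<comment> \<open>Since \<open>T > 0\<close>, the one-sided derivative at 0 is unique, so the
        choice in \<open>D\<close> does not affect this value.\<close>
      have "D z 0 = y' 0"
      proof (rule has_field_derivative_unique)
        show "(z has_real_derivative D z 0) (at 0 within {0..T})"
          using D[OF zs] T odeD(1)[of T z "D z" 0] by (simp add: P_def)
        show "(z has_real_derivative y' 0) (at 0 within {0..T})"
          using z T odeD(1)[of T z y' 0] by (simp add: P_def)
        show "at (0::real) within {0..T} \<noteq> bot" using T by (simp add: at_within_Icc_at_right)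
      qed
      then show "s \<in> (\<lambda>y. D y 0) ` solutions_P \<eta> T \<theta>" using y zs by (intro image_eqI[of _ _ z]) auto
    qed
  qed
  then show ?thesis by blast
qed

subsection \<open>Orbits inside the separatrices\<close>

text \<open>Writing an orbit inside the separatrix as \<open>y = Y * sin \<phi>\<close> turns the energy equation
  into \<open>\<phi>' = sqrt (R Y \<bar>sin \<phi>\<bar>)\<close>, which is regular at the turning points.\<close>

definition R :: "real \<Rightarrow> real \<Rightarrow> real" where
  "R Y s = 1 - 4 * \<eta>\<^sup>2 - 2 * \<eta> * Y * (1 + s\<^sup>2 / (1 + s)) - Y\<^sup>2 / 4 * (1 + s\<^sup>2)"

text \<open>The initial velocity of the orbit of amplitude \<open>Y\<close>: the angle starts at 0
  with speed \<open>sqrt (R Y 0)\<close>.\<close>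

definition V :: "real \<Rightarrow> real" where "V Y = Y * sqrt (R Y 0)"

text \<open>The time an orbit of amplitude \<open>Y\<close> takes to reach the angle \<open>b\<close>.\<close>

definition \<Theta> :: "real \<Rightarrow> real \<Rightarrow> real" where
  "\<Theta> Y b = integral {0..b} (\<lambda>u. 1 / sqrt (R Y \<bar>sin u\<bar>))"

section \<open>The regularized angular speed\<close>

lemma R_energy:
  assumes "0 \<le> Y" "0 \<le> s"
  shows "G \<eta> (Y * s) - G \<eta> Y = Y\<^sup>2 * (1 - s\<^sup>2) * R Y s"
proof -
  \<comment> \<open>The cubic term of \<open>G\<close> contributes
    \<open>(1 - s^3) / (1 - s^2) = 1 + w\<close>; the other terms divide without remainder.\<close>
  define w where "w = s\<^sup>2 / (1 + s)"
  have w: "(1 - s\<^sup>2) * w = (1 - s) * s\<^sup>2"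
    using assms by (simp add: w_def divide_simps) (simp add: algebra_simps power2_eq_square)
  have "Y\<^sup>2 * (1 - s\<^sup>2) * R Y s = Y\<^sup>2 * ((1 - s\<^sup>2) * (1 - 4 * \<eta>\<^sup>2 - 2 * \<eta> * Y - Y\<^sup>2 / 4 * (1 + s\<^sup>2))
      - 2 * \<eta> * Y * ((1 - s\<^sup>2) * w))"
    unfolding R_def w_def[symmetric] by (simp add: algebra_simps)
  then show ?thesis
    unfolding w using assms by (simp add: G_def power2_eq_square power3_eq_cube power4_eq_xxxx field_simps)
qed

text \<open>The squared angular speed at the turning point. It vanishes as \<open>Y\<close> reaches
  \<open>ys\<close>, which is the source of the diverging travel times.\<close>

lemma R_at_1: "2 * R Y 1 = (ys - Y) * (ys + Y + 6 * \<eta>)"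
proof -
  have "2 * R Y 1 = 2 - 8 * \<eta>\<^sup>2 - 6 * \<eta> * Y - Y\<^sup>2" by (simp add: R_def field_simps)
  then show ?thesis by (subst (asm) ys_quadratic[symmetric]) (simp add: power2_eq_square algebra_simps)
qed

text \<open>For \<open>0 \<le> Y\<close> the second factor is nonnegative, so \<open>R Y\<close> is
  smallest on \<open>{0..1}\<close> at the turning point; the exact form also gives the upper bound
  behind \<open>\<Theta>_diverges\<close>.\<close>

lemma R_minus_R_1:
  assumes "0 \<le> s"
  shows "R Y s - R Y 1 = (1 - s) * (\<eta> * Y * (1 + 2 * s) / (1 + s) + Y\<^sup>2 / 4 * (1 + s))"
  using assms by (simp add: R_def divide_simps) (simp add: power2_eq_square algebra_simps)

lemma R_pos:
  assumes "0 \<le> Y" "Y < ys" "0 \<le> s" "s \<le> 1"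
  shows "0 < R Y s"
proof -
  have "0 < 2 * R Y 1"
    unfolding R_at_1 using assms \<eta>_nonneg by (intro mult_pos_pos) auto
  moreover have "0 \<le> R Y s - R Y 1"
    unfolding R_minus_R_1[OF assms(3)] using assms \<eta>_nonneg
    by (intro mult_nonneg_nonneg add_nonneg_nonneg divide_nonneg_nonneg) auto
  ultimately show ?thesis by simp
qed

lemma R_antimono:
  assumes "0 \<le> Y" "Y < Z" "0 \<le> s"
  shows "R Z s < R Y s"
proof -
  have "2 * \<eta> * Y * (1 + s\<^sup>2 / (1 + s)) \<le> 2 * \<eta> * Z * (1 + s\<^sup>2 / (1 + s))"
    using assms \<eta>_nonneg by (intro mult_right_mono mult_left_mono add_nonneg_nonneg divide_nonneg_nonneg) auto
  moreover have "Y\<^sup>2 / 4 * (1 + s\<^sup>2) < Z\<^sup>2 / 4 * (1 + s\<^sup>2)"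
    using assms by (intro mult_strict_right_mono divide_strict_right_mono power_strict_mono) (auto intro: add_pos_nonneg)
  ultimately show ?thesis by (simp add: R_def)
qed

lemma R_le_1:
  assumes "0 \<le> Y" "0 \<le> s"
  shows "R Y s \<le> 1"
proof -
  have "0 \<le> 2 * \<eta> * Y * (1 + s\<^sup>2 / (1 + s))" "0 \<le> Y\<^sup>2 / 4 * (1 + s\<^sup>2)"
    using assms \<eta>_nonneg by (auto intro!: mult_nonneg_nonneg add_nonneg_nonneg divide_nonneg_nonneg)
  then show ?thesis using zero_le_power2[of \<eta>] unfolding R_def by linarith
qed

lemma continuous_on_R:
  assumes "continuous_on S f" "continuous_on S g" "\<And>x. x \<in> S \<Longrightarrow> 0 \<le> g x"
  shows "continuous_on S (\<lambda>x. R (f x) (g x))"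
proof -
  have "1 + g x \<noteq> 0" if "x \<in> S" for x using assms(3)[OF that] by simp
  with assms(1,2) show ?thesis unfolding R_def by (intro continuous_intros) auto
qed

lemma speed_pos: "0 \<le> Y \<Longrightarrow> Y < ys \<Longrightarrow> 0 < sqrt (R Y \<bar>sin u\<bar>)"
  by (simp add: R_pos)

lemma continuous_on_speed: "continuous_on S (\<lambda>u. sqrt (R Y \<bar>sin u\<bar>))"
  by (intro continuous_intros continuous_on_R) auto

lemma continuous_on_slowness:
  assumes "0 \<le> Y" "Y < ys"
  shows "continuous_on S (\<lambda>u. 1 / sqrt (R Y \<bar>sin u\<bar>))"
  using less_imp_neq[OF speed_pos[OF assms]] by (intro continuous_on_divide continuous_on_const continuous_on_speed) auto

lemma slowness_integrable:
  assumes "0 \<le> Y" "Y < ys"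
  shows "(\<lambda>u. 1 / sqrt (R Y \<bar>sin u\<bar>)) integrable_on {a..b}"
  by (intro integrable_continuous_real continuous_on_slowness assms)

section \<open>Travel time as a function of amplitude and angle\<close>

lemma continuous_on_\<Theta>:
  fixes S :: "real set"
  assumes "continuous_on S f" "continuous_on S g"
    "\<And>x. x \<in> S \<Longrightarrow> 0 \<le> f x \<and> f x < ys" "\<And>x. x \<in> S \<Longrightarrow> 0 \<le> g x"
  shows "continuous_on S (\<lambda>x. \<Theta> (f x) (g x))"
  unfolding \<Theta>_def
proof (rule continuous_on_integral_upper[where h = "\<lambda>x u. 1 / sqrt (R (f x) \<bar>sin u\<bar>)"])
  show "continuous_on S g" "\<And>x. x \<in> S \<Longrightarrow> 0 \<le> g x" by fact+
  have "sqrt (R (f x) \<bar>sin (g x * u)\<bar>) \<noteq> 0" if "x \<in> S" for x u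
    using speed_pos[of "f x" "g x * u"] assms(3)[OF that] by simp
  moreover have "continuous_on (S \<times> {0..1}) (\<lambda>p. f (fst p))" "continuous_on (S \<times> {0..1}) (\<lambda>p. g (fst p))"
    by (rule continuous_on_compose2[OF assms(1)] continuous_on_compose2[OF assms(2)];
        force intro: continuous_intros)+
  then have "continuous_on (S \<times> {0..1}) (\<lambda>p. sqrt (R (f (fst p)) \<bar>sin (g (fst p) * snd p)\<bar>))"
    by (intro continuous_on_real_sqrt continuous_on_R continuous_on_rabs continuous_on_sin
        continuous_on_mult continuous_on_snd continuous_on_id) auto
  ultimately show "continuous_on (S \<times> {0..1}) (\<lambda>(x, u). 1 / sqrt (R (f x) \<bar>sin (g x * u)\<bar>))"
    unfolding case_prod_unfold by (intro continuous_on_divide continuous_on_const) auto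
qed

lemma \<Theta>_0 [simp]: "\<Theta> Y 0 = 0"
  by (simp add: \<Theta>_def)

text \<open>The angular speed is at most 1 by \<open>R_le_1\<close>, so the time is at least the
  angle swept.\<close>

lemma \<Theta>_diff_ge:
  assumes Y: "0 \<le> Y" "Y < ys" and ab: "0 \<le> a" "a \<le> b"
  shows "b - a \<le> \<Theta> Y b - \<Theta> Y a"
proof -
  have "\<Theta> Y a + integral {a..b} (\<lambda>u. 1 / sqrt (R Y \<bar>sin u\<bar>)) = \<Theta> Y b"
    unfolding \<Theta>_def by (rule Henstock_Kurzweil_Integration.integral_combine[OF ab slowness_integrable[OF Y]])
  moreover have "integral {a..b} (\<lambda>u. 1) \<le> integral {a..b} (\<lambda>u. 1 / sqrt (R Y \<bar>sin u\<bar>))"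
    using speed_pos[OF Y] R_le_1[OF Y(1)]
    by (intro integral_le slowness_integrable[OF Y]) (auto simp: field_simps)
  ultimately show ?thesis using ab by simp
qed

lemma \<Theta>_ge: "0 \<le> Y \<Longrightarrow> Y < ys \<Longrightarrow> 0 \<le> b \<Longrightarrow> b \<le> \<Theta> Y b"
  using \<Theta>_diff_ge[of Y 0 b] by simp

lemma \<Theta>_strict_mono: "0 \<le> Y \<Longrightarrow> Y < ys \<Longrightarrow> 0 \<le> a \<Longrightarrow> a < b \<Longrightarrow> \<Theta> Y a < \<Theta> Y b"
  using \<Theta>_diff_ge[of Y a b] by simp

text \<open>By \<open>R_antimono\<close> a larger amplitude is slower at every angle.\<close>

lemma \<Theta>_strict_mono_amplitude:
  assumes Y: "0 \<le> Y" "Y < Z" "Z < ys" and b: "0 < b"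
  shows "\<Theta> Y b < \<Theta> Z b"
  unfolding \<Theta>_def
proof (rule integral_less_real)
  show "1 / sqrt (R Y \<bar>sin u\<bar>) < 1 / sqrt (R Z \<bar>sin u\<bar>)" for u
    using R_antimono[of Y Z "\<bar>sin u\<bar>"] speed_pos[of Z u] speed_pos[of Y u] Y
    by (intro divide_strict_left_mono mult_pos_pos) auto
qed (use Y b in \<open>auto intro: continuous_on_slowness\<close>)

lemma DERIV_\<Theta>:
  assumes Y: "0 \<le> Y" "Y < ys" and b: "0 < b"
  shows "(\<Theta> Y has_real_derivative 1 / sqrt (R Y \<bar>sin b\<bar>)) (at b)"
proof -
  have "((\<lambda>b. \<Theta> Y b) has_real_derivative 1 / sqrt (R Y \<bar>sin b\<bar>)) (at b within {0..b + 1})"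
    unfolding \<Theta>_def using b by (intro integral_has_real_derivative continuous_on_slowness Y) auto
  then show ?thesis using b by (simp add: at_within_Icc_at)
qed

text \<open>The speed depends on the absolute value of the sine, which has period \<open>pi\<close>;
  hence the time gained by the shift has derivative 0 in \<open>b\<close>.\<close>

lemma \<Theta>_add_pi:
  assumes Y: "0 \<le> Y" "Y < ys" and b: "0 \<le> b"
  shows "\<Theta> Y (b + pi) = \<Theta> Y b + \<Theta> Y pi"
proof (cases "b = 0")
  case False
  have "\<Theta> Y (b + pi) - \<Theta> Y b = \<Theta> Y (0 + pi) - \<Theta> Y 0"
  proof (rule DERIV_isconst_end[of 0 b])
    show "continuous_on {0..b} (\<lambda>b. \<Theta> Y (b + pi) - \<Theta> Y b)"
      by (intro continuous_intros continuous_on_\<Theta>) (use Y in auto)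
    show "((\<lambda>b. \<Theta> Y (b + pi) - \<Theta> Y b) has_real_derivative 0) (at x)" if "0 < x" "x < b" for x
      using that
      by (auto intro!: derivative_eq_intros DERIV_chain2[OF DERIV_\<Theta>[OF Y]] simp: add_pos_pos)
  qed (use b False in auto)
  then show ?thesis by simp
qed simp

text \<open>The sine is symmetric about \<open>pi / 2\<close>, so the sum of the two times has
  derivative 0.\<close>

lemma \<Theta>_pi_minus:
  assumes Y: "0 \<le> Y" "Y < ys" and b: "0 \<le> b" "b \<le> pi"
  shows "\<Theta> Y (pi - b) = \<Theta> Y pi - \<Theta> Y b"
proof (cases "b = 0")
  case False
  have "\<Theta> Y (pi - b) + \<Theta> Y b = \<Theta> Y (pi - 0) + \<Theta> Y 0"
  proof (rule DERIV_isconst_end[of 0 b])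
    show "continuous_on {0..b} (\<lambda>b. \<Theta> Y (pi - b) + \<Theta> Y b)"
      by (intro continuous_intros continuous_on_\<Theta>) (use Y b in auto)
    show "((\<lambda>b. \<Theta> Y (pi - b) + \<Theta> Y b) has_real_derivative 0) (at x)" if "0 < x" "x < b" for x
      using that b
      by (auto intro!: derivative_eq_intros DERIV_chain2[OF DERIV_\<Theta>[OF Y]])
  qed (use b False in auto)
  then show ?thesis by simp
qed simp

lemma \<Theta>_pi: "0 \<le> Y \<Longrightarrow> Y < ys \<Longrightarrow> \<Theta> Y pi = 2 * \<Theta> Y (pi / 2)"
  using \<Theta>_pi_minus[of Y "pi / 2"] by simp

lemma \<Theta>_mult_pi:
  assumes Y: "0 \<le> Y" "Y < ys" and b: "0 \<le> b"
  shows "\<Theta> Y (real n * pi + b) = 2 * real n * \<Theta> Y (pi / 2) + \<Theta> Y b"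
proof (induction n)
  case (Suc n)
  have "\<Theta> Y (real (Suc n) * pi + b) = \<Theta> Y ((real n * pi + b) + pi)" by (simp add: algebra_simps)
  also have "\<dots> = \<Theta> Y (real n * pi + b) + \<Theta> Y pi" using b by (intro \<Theta>_add_pi Y) auto
  finally show ?case using Suc \<Theta>_pi[OF Y] by (simp add: algebra_simps)
qed simp

text \<open>Once \<open>ys - Y \<le> e\<close>, the squared speed is at most
  \<open>C * ((pi / 2 - u)^2 + e)\<close>: \<open>R_at_1\<close> accounts for \<open>e\<close> and
  \<open>R_minus_R_1\<close> for the square. \<open>integral_inverse_sqrt_diverges\<close> then
  applies.\<close>

lemma \<Theta>_diverges:
  obtains Z where "0 \<le> Z" "Z < ys" "\<And>Y. Z \<le> Y \<Longrightarrow> Y < ys \<Longrightarrow> M \<le> \<Theta> Y (pi / 2)"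
proof -
  \<comment> \<open>\<open>C\<close> dominates the cofactor in \<open>R_minus_R_1\<close>, and
    \<open>2 * C\<close> the factor \<open>ys + Y + 6 * \<eta>\<close> in
    \<open>R_at_1\<close>.\<close>
  define C where "C = ys + 3 * \<eta> + 2 * \<eta> * ys + ys\<^sup>2"
  have C: "C > 0" using ys_pos \<eta>_nonneg by (auto simp: C_def intro!: add_pos_nonneg)
  obtain e where e: "0 < e"
    "\<And>a h. \<lbrakk>pi / 2 \<le> a; continuous_on {0..a} h;
       \<And>u. u \<in> {0..a} \<Longrightarrow> 0 < h u \<and> h u \<le> C * ((a - u)\<^sup>2 + e)\<rbrakk>
       \<Longrightarrow> M \<le> integral {0..a} (\<lambda>u. 1 / sqrt (h u))"
    using integral_inverse_sqrt_diverges[of "pi / 2" C M] C by auto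
  show thesis
  proof (rule that[of "max 0 (ys - e)"])
    fix Y assume Y: "max 0 (ys - e) \<le> Y" "Y < ys"
    show "M \<le> \<Theta> Y (pi / 2)"
      unfolding \<Theta>_def
    proof (rule e(2))
      fix u assume u: "u \<in> {0..pi / 2}"
      define s where "s = sin u"
      have s: "0 \<le> s" "s \<le> 1" using u by (auto simp: s_def sin_ge_zero)
      have "1 - s \<le> (pi / 2 - u)\<^sup>2"
      proof -
        have "cos (pi / 2 - u) = s" by (simp add: s_def cos_diff)
        then show ?thesis using one_minus_cos_le[of "pi / 2 - u"] zero_le_power2[of "pi / 2 - u"] by linarith
      qed
      moreover have "\<eta> * Y * (1 + 2 * s) / (1 + s) + Y\<^sup>2 / 4 * (1 + s) \<le> C"
      proof -
        have "(1 + 2 * s) / (1 + s) \<le> 2" using s by (simp add: field_simps)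
        then have "\<eta> * Y * ((1 + 2 * s) / (1 + s)) \<le> \<eta> * ys * 2"
          using Y \<eta>_nonneg s by (intro mult_mono) auto
        moreover have "Y\<^sup>2 / 4 * (1 + s) \<le> ys\<^sup>2 / 4 * 2"
          using Y s by (intro mult_mono divide_right_mono power_mono) auto
        moreover have "0 \<le> ys\<^sup>2" by simp
        ultimately have "\<eta> * Y * ((1 + 2 * s) / (1 + s)) + Y\<^sup>2 / 4 * (1 + s) \<le> C"
          unfolding C_def using ys_pos \<eta>_nonneg by linarith
        then show ?thesis by simp
      qed
      moreover have "0 \<le> 1 - s" using s by simp
      moreover have "0 \<le> C" using C by simp
      ultimately have "R Y s - R Y 1 \<le> (pi / 2 - u)\<^sup>2 * C"
        unfolding R_minus_R_1[OF s(1)]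
        using Y \<eta>_nonneg s by (intro mult_mono add_nonneg_nonneg mult_nonneg_nonneg divide_nonneg_nonneg) auto
      moreover have "R Y 1 \<le> e * C"
      proof -
        have "2 * R Y 1 \<le> e * (2 * C)"
          unfolding R_at_1 using Y ys_pos \<eta>_nonneg e(1)
          by (intro mult_mono) (auto simp: C_def intro!: mult_nonneg_nonneg add_increasing2)
        then show ?thesis by simp
      qed
      ultimately have "R Y s \<le> C * ((pi / 2 - u)\<^sup>2 + e)" by (simp add: algebra_simps)
      moreover have "0 < R Y s" using Y s by (intro R_pos) auto
      moreover have "\<bar>sin u\<bar> = s" using s by (simp add: s_def)
      ultimately show "0 < R Y \<bar>sin u\<bar> \<and> R Y \<bar>sin u\<bar> \<le> C * ((pi / 2 - u)\<^sup>2 + e)" by simp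
    qed (auto intro!: continuous_intros continuous_on_R)
  qed (use ys_pos e in auto)
qed

section \<open>Orbits from the angle equation\<close>

lemma DERIV_R_sin:
  "((\<lambda>u. R Y \<bar>sin u\<bar>) has_real_derivative
     (- 2 * \<eta> * Y * (sin u * (2 + \<bar>sin u\<bar>) / (1 + \<bar>sin u\<bar>)\<^sup>2) - Y\<^sup>2 / 2 * sin u) * cos u) (at u)"
proof -
  have "((\<lambda>u. (sin u)\<^sup>2 / (1 + \<bar>sin u\<bar>)) has_real_derivative
      (sin u * (2 + \<bar>sin u\<bar>) / (1 + \<bar>sin u\<bar>)\<^sup>2) * cos u) (at u)"
    by (rule DERIV_chain2[OF has_real_derivative_sq_div_abs DERIV_sin])
  moreover define q where "q = sin u * (2 + \<bar>sin u\<bar>) / (1 + \<bar>sin u\<bar>)\<^sup>2"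
  ultimately have D: "((\<lambda>u. (sin u)\<^sup>2 / (1 + \<bar>sin u\<bar>)) has_real_derivative q * cos u) (at u)"
    by simp
  have "((\<lambda>u. 1 - 4 * \<eta>\<^sup>2 - 2 * \<eta> * Y * (1 + (sin u)\<^sup>2 / (1 + \<bar>sin u\<bar>)) - Y\<^sup>2 / 4 * (1 + (sin u)\<^sup>2))
      has_real_derivative
      (- 2 * \<eta> * Y * q - Y\<^sup>2 / 2 * sin u) * cos u) (at u)"
    by (rule D derivative_eq_intros refl)+ (simp add: algebra_simps)
  then show ?thesis by (simp add: R_def q_def)
qed

text \<open>The right side is the second derivative of \<open>Y * sin p\<close> when
  \<open>p' = sqrt (R Y \<bar>sin p\<bar>)\<close> and \<open>s = sin p\<close>. The identity thus
  says that the angle equation reproduces the force.\<close>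

lemma force_angle:
  assumes "0 \<le> Y" "\<bar>s\<bar> \<le> 1"
  shows "force (Y * s) = Y * ((1 - s\<^sup>2) * (- 2 * \<eta> * Y * (s * (2 + \<bar>s\<bar>) / (1 + \<bar>s\<bar>)\<^sup>2) - Y\<^sup>2 / 2 * s) / 2
           - s * R Y \<bar>s\<bar>)"
proof -
  define a where "a = \<bar>s\<bar>"
  have a: "0 \<le> a" "s\<^sup>2 = a\<^sup>2" by (simp_all add: a_def)
  have 1: "(1 - a\<^sup>2) * (s * (2 + a) / (1 + a)\<^sup>2) = s * (2 + a) * ((1 - a) / (1 + a))"
    using a by (simp add: divide_simps) (simp add: power2_eq_square algebra_simps)
  \<comment> \<open>This collapse produces the term of the force with coefficient
    \<open>3 * \<eta>\<close>.\<close>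
  have 2: "2 * (1 + a\<^sup>2 / (1 + a)) - (2 + a) * ((1 - a) / (1 + a)) = 3 * a"
    using a by (simp add: divide_simps) (simp add: power2_eq_square algebra_simps)
  have "Y * ((1 - a\<^sup>2) * (- 2 * \<eta> * Y * q - Y\<^sup>2 / 2 * s) / 2 - s * R Y a)
     = Y * (- \<eta> * Y * ((1 - a\<^sup>2) * q) - Y\<^sup>2 / 4 * s * (1 - a\<^sup>2) - s * R Y a)" for q
    by (simp add: field_simps)
  then have "Y * ((1 - a\<^sup>2) * (- 2 * \<eta> * Y * (s * (2 + a) / (1 + a)\<^sup>2) - Y\<^sup>2 / 2 * s) / 2 - s * R Y a)
     = Y * (- \<eta> * Y * ((1 - a\<^sup>2) * (s * (2 + a) / (1 + a)\<^sup>2)) - Y\<^sup>2 / 4 * s * (1 - a\<^sup>2) - s * R Y a)" .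
  also have "\<dots> = Y * s * (\<eta> * Y * (2 * (1 + a\<^sup>2 / (1 + a)) - (2 + a) * ((1 - a) / (1 + a)))
       - Y\<^sup>2 / 4 * (1 - a\<^sup>2) + Y\<^sup>2 / 4 * (1 + a\<^sup>2) - (1 - 4 * \<eta>\<^sup>2))"
    unfolding 1 R_def by (simp add: algebra_simps del: times_divide_eq_left times_divide_eq_right)
  also have "\<dots> = Y * s * (3 * \<eta> * Y * a + Y\<^sup>2 / 2 * a\<^sup>2 - (1 - 4 * \<eta>\<^sup>2))"
    unfolding 2 by (simp add: field_simps)
  also have "\<dots> = Y * s * (3 * \<eta> * Y * a + Y\<^sup>2 / 2 * s\<^sup>2 - (1 - 4 * \<eta>\<^sup>2))" using a by simp
  also have "\<dots> = force (Y * s)"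
    using assms(1) by (simp add: force_def a_def abs_mult power2_eq_square power3_eq_cube field_simps)
  finally show ?thesis unfolding a_def by (simp only: power2_abs)
qed

text \<open>The angular speed stays positive, so separation of variables carries the orbit through
  all its turning points at once.\<close>

lemma oscillation:
  assumes Y: "0 < Y" "Y < ys" and b: "0 \<le> b" "\<Theta> Y b = T"
  obtains y y' where "ode T y y'" "y 0 = 0" "y' 0 = V Y" "y T = Y * sin b"
    "y' T = Y * (cos b * sqrt (R Y \<bar>sin b\<bar>))"
proof -
  define g where "g u = sqrt (R Y \<bar>sin u\<bar>)" for u
  have gpos: "0 < g u" for u using speed_pos[of Y u] Y by (simp add: g_def)
  have cont: "continuous_on {0..b} g" unfolding g_def by (rule continuous_on_speed)
  have T: "integral {0..b} (\<lambda>u. 1 / g u) = T" using b(2) by (simp add: \<Theta>_def g_def)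
  obtain p where p: "p 0 = 0" "p T = b"
    "\<And>t. t \<in> {0..T} \<Longrightarrow> (p has_real_derivative g (p t)) (at t within {0..T})"
    by (rule separable_ode_solution[OF b(1) cont gpos T]) blast
  show thesis
  proof (rule that[of "\<lambda>t. Y * sin (p t)" "\<lambda>t. Y * (cos (p t) * g (p t))"])
    show "ode T (\<lambda>t. Y * sin (p t)) (\<lambda>t. Y * (cos (p t) * g (p t)))"
      unfolding ode_def
    proof (intro ballI conjI)
      fix t assume t: "t \<in> {0..T}"
      note dp = p(3)[OF t]
      show "((\<lambda>t. Y * sin (p t)) has_real_derivative Y * (cos (p t) * g (p t))) (at t within {0..T})"
        using dp by (auto intro!: derivative_eq_intros)
      define u where "u = p t"
      define d where "d = - 2 * \<eta> * Y * (sin u * (2 + \<bar>sin u\<bar>) / (1 + \<bar>sin u\<bar>)\<^sup>2) - Y\<^sup>2 / 2 * sin u"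
      have R: "0 < R Y \<bar>sin u\<bar>" and gg: "g u * g u = R Y \<bar>sin u\<bar>"
        using Y R_pos[of Y "\<bar>sin u\<bar>"] by (auto simp: g_def)
      have dR: "((\<lambda>u. R Y \<bar>sin u\<bar>) has_real_derivative d * cos u) (at u)"
        unfolding d_def by (rule DERIV_R_sin)
      have "(g has_real_derivative d * cos u / (2 * g u)) (at u)"
        unfolding g_def using R
        by (auto intro!: derivative_eq_intros dR simp: divide_simps)
      \<comment> \<open>The chain rule multiplies by \<open>p' = g (p t)\<close>, which cancels the
        \<open>g u\<close> in the denominator.\<close>
      then have dg: "((\<lambda>t. g (p t)) has_real_derivative d * cos u / 2) (at t within {0..T})"
        using DERIV_chain2[of g "d * cos u / (2 * g u)" p t, OF _ dp] gpos[of u] by (simp add: u_def)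
      have "((\<lambda>t. Y * (cos (p t) * g (p t))) has_real_derivative
          Y * (cos u * (d * cos u / 2) - sin u * (g u * g u))) (at t within {0..T})"
        using dp dg by (auto intro!: derivative_eq_intros simp: u_def)
      also have "Y * (cos u * (d * cos u / 2) - sin u * (g u * g u)) = force (Y * sin u)"
      proof -
        have "cos u * (d * cos u / 2) = (1 - (sin u)\<^sup>2) * d / 2"
          unfolding cos_squared_eq[symmetric] by (simp add: power2_eq_square)
        then show ?thesis using Y unfolding gg d_def by (subst force_angle) auto
      qed
      finally show "((\<lambda>t. Y * (cos (p t) * g (p t))) has_real_derivative force (Y * sin (p t))) (at t within {0..T})"
        by (simp add: u_def)
    qed
  qed (use p in \<open>simp_all add: V_def g_def\<close>)
qed

section \<open>Amplitudes, initial velocities and the integrals \<open>Tint\<close> and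
  \<open>Hint\<close>\<close>

lemma V_sq:
  assumes "0 \<le> Y" "Y < ys"
  shows "(V Y)\<^sup>2 = - G \<eta> Y"
  using R_energy[of Y 0] R_pos[of Y 0] assms by (simp add: V_def power_mult_distrib)

lemma V_pos: "0 < Y \<Longrightarrow> Y < ys \<Longrightarrow> 0 < V Y"
  using R_pos[of Y 0] by (simp add: V_def)

lemma V_strict_mono:
  assumes "0 < Y" "Y < Z" "Z < ys"
  shows "V Y < V Z"
proof (rule power2_less_imp_less)
  show "(V Y)\<^sup>2 < (V Z)\<^sup>2" using assms G_strict_decreasing[of Y Z] by (simp add: V_sq)
qed (use V_pos[of Z] assms in simp)

lemma V_inject: "0 < Y \<Longrightarrow> Y < ys \<Longrightarrow> 0 < Z \<Longrightarrow> Z < ys \<Longrightarrow> V Y = V Z \<Longrightarrow> Y = Z"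
  using V_strict_mono[of Y Z] V_strict_mono[of Z Y] by (cases Y Z rule: linorder_cases) auto

lemma V_less_v0: "0 < Y \<Longrightarrow> Y < ys \<Longrightarrow> V Y < v0 \<eta>"
proof (rule power2_less_imp_less)
  show "(V Y)\<^sup>2 < (v0 \<eta>)\<^sup>2" if "0 < Y" "Y < ys"
    using that G_strict_decreasing[of Y ys] by (simp add: V_sq v0_sq)
qed (use v0_pos in simp)

lemma V_surj:
  assumes "0 < v" "v < v0 \<eta>"
  obtains Y where "0 < Y" "Y < ys" "V Y = v"
proof -
  have v: "v\<^sup>2 < (v0 \<eta>)\<^sup>2" using assms by (intro power_strict_mono) auto
  then have "\<exists>Y\<ge>0. Y \<le> ys \<and> - G \<eta> Y = v\<^sup>2"
    using ys_pos by (intro IVT') (auto simp: v0_sq intro!: continuous_intros)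
  then obtain Y where Y: "0 \<le> Y" "Y \<le> ys" "- G \<eta> Y = v\<^sup>2" by blast
  have "Y \<noteq> 0" "Y \<noteq> ys" using Y(3) v assms by (auto simp: v0_sq)
  then have Y': "0 < Y" "Y < ys" using Y by auto
  then have "(V Y)\<^sup>2 = v\<^sup>2" using Y by (simp add: V_sq)
  then have "V Y = v" using V_pos[OF Y'] assms by (simp add: power2_eq_iff_nonneg)
  with Y' show thesis by (rule that)
qed

text \<open>\<open>G \<eta>\<close> decreases strictly on \<open>{0..ys}\<close>, so there is no
  smaller positive root.\<close>

lemma yroot_V:
  assumes "0 < Y" "Y < ys"
  shows "yroot \<eta> (V Y) = Y"
  unfolding yroot_def
proof (rule Least_equality)
  show "0 < Y \<and> G \<eta> Y + (V Y)\<^sup>2 = 0" using assms by (simp add: V_sq)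
  fix z assume z: "0 < z \<and> G \<eta> z + (V Y)\<^sup>2 = 0"
  then have "G \<eta> z = G \<eta> Y" using assms by (simp add: V_sq)
  then show "Y \<le> z" using G_strict_decreasing[of z Y] z assms by (cases "z < Y") auto
qed

text \<open>The substitution \<open>z = Y * sin u\<close> gives the antiderivative
  \<open>\<Theta> Y (arcsin (z / Y))\<close>. It is continuous up to \<open>z = Y\<close> and
  differentiable inside, which is enough despite the singular endpoint. The lower end
  \<open>a\<close> is 0 for \<open>Tint\<close> and \<open>sqrt (R Y 0)\<close> for
  \<open>Hint\<close>.\<close>

lemma time_integral:
  assumes Y: "0 < Y" "Y < ys" and a: "0 \<le> a" "a \<le> 1"
  shows "((\<lambda>z. 1 / sqrt (G \<eta> z + (V Y)\<^sup>2)) has_integral (\<Theta> Y (pi / 2) - \<Theta> Y (arcsin a))) {Y * a..Y}"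
proof -
  have "((\<lambda>z. 1 / sqrt (G \<eta> z + (V Y)\<^sup>2)) has_integral
     (\<Theta> Y (arcsin (Y / Y)) - \<Theta> Y (arcsin (Y * a / Y)))) {Y * a..Y}"
  proof (rule fundamental_theorem_of_calculus_interior)
    show "Y * a \<le> Y" using Y a by simp
    have w: "0 \<le> z / Y \<and> z / Y \<le> 1" if "z \<in> {Y * a..Y}" for z
      using that Y a order_trans[of 0 "Y * a" z] by (auto simp: field_simps)
    show "continuous_on {Y * a..Y} (\<lambda>z. \<Theta> Y (arcsin (z / Y)))"
    proof (intro continuous_on_\<Theta> continuous_on_const continuous_on_arcsin continuous_on_divide continuous_on_id)
      show "\<forall>z\<in>{Y * a..Y}. - 1 \<le> z / Y \<and> z / Y \<le> 1" using w by force
      show "0 \<le> arcsin (z / Y)" if "z \<in> {Y * a..Y}" for z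
        using arcsin_le_arcsin[of 0 "z / Y"] w[OF that] by simp
    qed (use Y in auto)
    fix z assume z: "z \<in> {Y * a<..<Y}"
    define w where "w = z / Y"
    have "0 < z" using z a Y by (auto intro: le_less_trans[of 0 "Y * a"])
    then have w: "0 < w" "w < 1" and zw: "z = Y * w" using z Y by (auto simp: w_def)
    have as: "0 < arcsin w" using arcsin_less_arcsin[of 0 w] w by simp
    have "((\<lambda>z. arcsin (z / Y)) has_real_derivative inverse (sqrt (1 - w\<^sup>2)) * (1 / Y)) (at z)"
    proof (rule DERIV_chain2[where f = arcsin and g = "\<lambda>z. z / Y"])
      show "(arcsin has_real_derivative inverse (sqrt (1 - w\<^sup>2))) (at (z / Y))"
        using DERIV_arcsin[of w] w by (simp add: w_def)
    qed (use Y in \<open>auto intro!: derivative_eq_intros\<close>)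
    moreover have "(\<Theta> Y has_real_derivative 1 / sqrt (R Y \<bar>sin (arcsin w)\<bar>)) (at (arcsin (z / Y)))"
      using DERIV_\<Theta>[of Y "arcsin w"] Y as by (simp add: w_def)
    ultimately have "((\<lambda>z. \<Theta> Y (arcsin (z / Y))) has_real_derivative
        1 / sqrt (R Y \<bar>sin (arcsin w)\<bar>) * (inverse (sqrt (1 - w\<^sup>2)) * (1 / Y))) (at z)"
      by (rule DERIV_chain2[where f = "\<Theta> Y" and g = "\<lambda>z. arcsin (z / Y)", rotated])
    also have "1 / sqrt (R Y \<bar>sin (arcsin w)\<bar>) * (inverse (sqrt (1 - w\<^sup>2)) * (1 / Y)) = 1 / sqrt (G \<eta> z + (V Y)\<^sup>2)"
    proof -
      have "G \<eta> z + (V Y)\<^sup>2 = Y\<^sup>2 * (1 - w\<^sup>2) * R Y w"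
        using R_energy[of Y w] Y w by (simp add: zw V_sq)
      then have "sqrt (G \<eta> z + (V Y)\<^sup>2) = Y * sqrt (1 - w\<^sup>2) * sqrt (R Y w)"
        using Y by (simp add: real_sqrt_mult)
      then show ?thesis using w by (simp add: inverse_eq_divide)
    qed
    finally show "((\<lambda>z. \<Theta> Y (arcsin (z / Y))) has_vector_derivative 1 / sqrt (G \<eta> z + (V Y)\<^sup>2)) (at z)"
      by (simp add: has_real_derivative_iff_has_vector_derivative)
  qed
  with Y show ?thesis by simp
qed

text \<open>The angle at which an orbit of amplitude \<open>Y\<close> satisfies \<open>y = V Y\<close>.\<close>

definition \<alpha> :: "real \<Rightarrow> real" where "\<alpha> Y = arcsin (sqrt (R Y 0))"

lemma R_0_bounds: "0 \<le> Y \<Longrightarrow> Y < ys \<Longrightarrow> 0 < R Y 0 \<and> R Y 0 \<le> 1"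
  using R_pos[of Y 0] R_le_1[of Y 0] by simp

lemma sqrt_R_0_bounds: "0 \<le> Y \<Longrightarrow> Y < ys \<Longrightarrow> 0 < sqrt (R Y 0) \<and> sqrt (R Y 0) \<le> 1 \<and> - 1 \<le> sqrt (R Y 0)"
  using R_0_bounds[of Y] real_sqrt_ge_zero[of "R Y 0"] by (auto simp del: real_sqrt_ge_zero real_sqrt_ge_0_iff)

lemma \<alpha>_bounds:
  assumes "0 \<le> Y" "Y < ys"
  shows "0 < \<alpha> Y" "\<alpha> Y \<le> pi / 2"
  using arcsin_less_arcsin[of 0 "sqrt (R Y 0)"] arcsin_ubound[of "sqrt (R Y 0)"] sqrt_R_0_bounds[OF assms]
  unfolding \<alpha>_def by auto

lemma \<alpha>_antimono: "0 \<le> Y \<Longrightarrow> Y < Z \<Longrightarrow> Z < ys \<Longrightarrow> \<alpha> Z < \<alpha> Y"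
  using R_antimono[of Y Z 0] sqrt_R_0_bounds[of Y] sqrt_R_0_bounds[of Z]
  unfolding \<alpha>_def by (intro arcsin_less_arcsin) simp_all

lemma continuous_on_\<alpha>: "continuous_on {0..<ys} \<alpha>"
  unfolding \<alpha>_def
proof (intro continuous_intros continuous_on_R ballI)
  fix Y assume "Y \<in> {0..<ys}"
  with sqrt_R_0_bounds[of Y] show "- 1 \<le> sqrt (R Y 0) \<and> sqrt (R Y 0) \<le> 1" by simp
qed auto

lemma sin_\<alpha>: "0 \<le> Y \<Longrightarrow> Y < ys \<Longrightarrow> sin (\<alpha> Y) = sqrt (R Y 0)"
  using sqrt_R_0_bounds[of Y] unfolding \<alpha>_def by (intro sin_arcsin) simp_all

text \<open>The \<open>k\<close>-th time at which the state \<open>x\<close> of an orbit of amplitude \<open>Y\<close> vanishes.\<close>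

definition \<tau> :: "nat \<Rightarrow> real \<Rightarrow> real" where "\<tau> k Y = \<Theta> Y (real k * pi - \<alpha> Y)"

section \<open>The times at which the state vanishes\<close>

lemma k_pi_minus_\<alpha>:
  assumes "0 \<le> Y" "Y < ys" "1 \<le> k"
  shows "pi / 2 \<le> real k * pi - \<alpha> Y" "real k \<le> real k * pi - \<alpha> Y"
proof -
  have k: "1 \<le> real k" using assms by simp
  have "1 * pi \<le> real k * pi" using k by (intro mult_right_mono) auto
  then show "pi / 2 \<le> real k * pi - \<alpha> Y" using \<alpha>_bounds[OF assms(1,2)] by linarith
  have "1 * (pi - 1) \<le> real k * (pi - 1)" using k pi_gt3 by (intro mult_right_mono) auto
  then show "real k \<le> real k * pi - \<alpha> Y"
    using \<alpha>_bounds[OF assms(1,2)] pi_gt3 by (simp add: algebra_simps)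
qed

lemma \<tau>_eq:
  assumes "0 \<le> Y" "Y < ys" "1 \<le> k"
  shows "\<tau> k Y = 2 * real k * \<Theta> Y (pi / 2) - \<Theta> Y (\<alpha> Y)"
proof -
  \<comment> \<open>Splits off the \<open>k - 1\<close> complete half turns before the last angle
    \<open>pi - \<alpha> Y\<close>.\<close>
  obtain n where n: "k = Suc n" using assms(3) by (cases k) auto
  have "\<tau> k Y = \<Theta> Y (real n * pi + (pi - \<alpha> Y))" by (simp add: \<tau>_def n algebra_simps)
  also have "\<dots> = 2 * real n * \<Theta> Y (pi / 2) + \<Theta> Y (pi - \<alpha> Y)"
    using \<alpha>_bounds[OF assms(1,2)] pi_gt_zero by (intro \<Theta>_mult_pi assms) linarith
  also have "\<Theta> Y (pi - \<alpha> Y) = 2 * \<Theta> Y (pi / 2) - \<Theta> Y (\<alpha> Y)"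
    using \<alpha>_bounds[OF assms(1,2)] pi_gt_zero \<Theta>_pi[OF assms(1,2)]
    by (subst \<Theta>_pi_minus) (use assms in linarith)+
  finally show ?thesis by (simp add: n algebra_simps)
qed

text \<open>\<open>Tint\<close> is the time of a quarter turn. \<open>Hint\<close> starts at
  \<open>V Y = Y * sin (\<alpha> Y)\<close>, hence lacks the time up to the angle
  \<open>\<alpha> Y\<close>.\<close>

lemma Tk_V:
  assumes Y: "0 < Y" "Y < ys" and k: "1 \<le> k"
  shows "Tk \<eta> k (V Y) = \<tau> k Y"
proof -
  have "Tint \<eta> (V Y) = \<Theta> Y (pi / 2)"
    unfolding Tint_def yroot_V[OF Y] using integral_unique[OF time_integral[OF Y, of 0]] by simp
  moreover have "Hint \<eta> (V Y) = \<Theta> Y (pi / 2) - \<Theta> Y (\<alpha> Y)"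
    unfolding Hint_def yroot_V[OF Y] \<alpha>_def
    using integral_unique[OF time_integral[OF Y, of "sqrt (R Y 0)"]] R_0_bounds[of Y] Y
    by (simp add: V_def)
  ultimately show ?thesis using Y k by (simp add: Tk_def \<tau>_eq algebra_simps)
qed

text \<open>Two effects add up: a larger amplitude has a smaller \<open>\<alpha>\<close>, hence a
  larger target angle, and it moves more slowly.\<close>

lemma \<tau>_strict_mono:
  assumes "0 \<le> Y" "Y < Z" "Z < ys" "1 \<le> k"
  shows "\<tau> k Y < \<tau> k Z"
proof -
  have "\<tau> k Y < \<Theta> Y (real k * pi - \<alpha> Z)"
    unfolding \<tau>_def using \<alpha>_antimono[of Y Z] k_pi_minus_\<alpha>(2)[of Y k] assms
    by (intro \<Theta>_strict_mono) auto
  also have "\<dots> < \<tau> k Z"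
    unfolding \<tau>_def using k_pi_minus_\<alpha>(2)[of Z k] assms
    by (intro \<Theta>_strict_mono_amplitude) auto
  finally show ?thesis .
qed

lemma \<tau>_ge: "0 \<le> Y \<Longrightarrow> Y < ys \<Longrightarrow> 1 \<le> k \<Longrightarrow> real k \<le> \<tau> k Y"
  unfolding \<tau>_def using k_pi_minus_\<alpha>(2)[of Y k] \<Theta>_ge[of Y "real k * pi - \<alpha> Y"] by linarith

text \<open>The target angles differ by at least \<open>pi\<close>, and the angular speed is at most
  1.\<close>

lemma \<tau>_less_Suc:
  assumes "0 \<le> Y" "Y < ys" "1 \<le> k" "k < l"
  shows "\<tau> k Y + 1 \<le> \<tau> l Y"
proof -
  have "real k + 1 \<le> real l" using assms by simp
  then have "(real k + 1) * pi \<le> real l * pi" by (intro mult_right_mono) auto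
  then have "1 \<le> (real l * pi - \<alpha> Y) - (real k * pi - \<alpha> Y)" using pi_gt3 by (simp add: algebra_simps)
  then show ?thesis
    unfolding \<tau>_def using k_pi_minus_\<alpha>(2)[of Y k] assms
      \<Theta>_diff_ge[of Y "real k * pi - \<alpha> Y" "real l * pi - \<alpha> Y"] by linarith
qed

lemma continuous_on_\<tau>: "1 \<le> k \<Longrightarrow> continuous_on {0..<ys} (\<tau> k)"
  unfolding \<tau>_def
  by (intro continuous_on_\<Theta> continuous_intros continuous_on_\<alpha>)
     (use k_pi_minus_\<alpha>(2)[of _ k] in \<open>force dest: order_trans[of 0 "real k"]\<close>)+

text \<open>Intermediate value theorem between \<open>Y\<close> and an amplitude so close to
  \<open>ys\<close> that a quarter turn alone takes time at least \<open>T\<close>.\<close>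

lemma \<tau>_hits:
  assumes "0 < Y" "Y < ys" "1 \<le> k" "\<tau> k Y < T"
  obtains Z where "0 < Z" "Z < ys" "\<tau> k Z = T"
proof -
  obtain W where W: "0 \<le> W" "W < ys" "\<And>Y. W \<le> Y \<Longrightarrow> Y < ys \<Longrightarrow> T \<le> \<Theta> Y (pi / 2)"
    by (rule \<Theta>_diverges[of T]) blast
  define Z where "Z = max W Y"
  have Z: "Y \<le> Z" "Z < ys" "W \<le> Z" using W assms by (auto simp: Z_def)
  have "T \<le> \<Theta> Z (pi / 2)" using W Z by simp
  also have "\<dots> \<le> \<tau> k Z"
    unfolding \<tau>_def using k_pi_minus_\<alpha>(1)[of Z k] \<Theta>_diff_ge[of Z "pi / 2" "real k * pi - \<alpha> Z"] assms Z by simp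
  finally have "\<exists>X\<ge>Y. X \<le> Z \<and> \<tau> k X = T"
    using assms Z by (intro IVT') (auto intro!: continuous_on_subset[OF continuous_on_\<tau>[OF assms(3)]])
  then obtain X where "Y \<le> X" "X \<le> Z" "\<tau> k X = T" by blast
  with assms Z show thesis by (intro that[of X]) auto
qed

text \<open>\<open>Tk \<eta> k\<close> increases in \<open>v\<close>, so its limit at 0 is its
  infimum. Exceeding the infimum means exceeding some value of \<open>\<tau> k\<close>, and
  \<open>\<tau>_hits\<close> then attains \<open>T\<close>.\<close>

lemma Tk0_less_iff:
  assumes k: "1 \<le> k"
  shows "Tk0 \<eta> k < T \<longleftrightarrow> (\<exists>Y. 0 < Y \<and> Y < ys \<and> \<tau> k Y = T)"
proof -
  let ?f = "Tk \<eta> k" and ?A = "{0<..<v0 \<eta>}"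
  have mono: "?f v < ?f w" if vw: "0 < v" "v < w" "w < v0 \<eta>" for v w
  proof -
    obtain Y where Y: "0 < Y" "Y < ys" "V Y = v" by (rule V_surj[of v]) (use vw in simp_all)
    obtain Z where Z: "0 < Z" "Z < ys" "V Z = w" by (rule V_surj[of w]) (use vw in simp_all)
    have "Y < Z" using V_strict_mono[of Z Y] Y Z vw by (cases Y Z rule: linorder_cases) auto
    then show ?thesis using Tk_V[OF Y(1,2) k] Tk_V[OF Z(1,2) k] \<tau>_strict_mono[of Y Z k] Y Z k by simp
  qed
  have bdd: "0 \<le> ?f v" if vw: "0 < v" "v < v0 \<eta>" for v
  proof -
    obtain Y where Y: "0 < Y" "Y < ys" "V Y = v" by (rule V_surj[of v]) (use vw in simp_all)
    then show ?thesis using Tk_V[OF Y(1,2) k] \<tau>_ge[of Y k] k by simp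
  qed
  have "at 0 within ?A \<noteq> bot" using v0_pos by (simp add: trivial_limit_within islimpt_greaterThanLessThan1)
  from tendsto_Lim[OF this tendsto_strict_mono_at_0[OF v0_pos mono bdd]]
  have Tk0: "Tk0 \<eta> k = Inf (?f ` ?A)" by (simp add: Tk0_def)
  have bd: "bdd_below (?f ` ?A)" using bdd by (auto intro!: bdd_belowI)
  have "Tk0 \<eta> k < T \<longleftrightarrow> (\<exists>v\<in>?A. ?f v < T)"
    unfolding Tk0 using cInf_less_iff[OF _ bd, of T] v0_pos by auto
  also have "\<dots> \<longleftrightarrow> (\<exists>Y. 0 < Y \<and> Y < ys \<and> \<tau> k Y < T)"
  proof
    assume "\<exists>v\<in>?A. ?f v < T"
    then obtain v where v: "0 < v" "v < v0 \<eta>" "?f v < T" by auto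
    obtain Y where Y: "0 < Y" "Y < ys" "V Y = v" by (rule V_surj[OF v(1,2)])
    then show "\<exists>Y. 0 < Y \<and> Y < ys \<and> \<tau> k Y < T" using Tk_V[OF Y(1,2) k] v by auto
  next
    assume "\<exists>Y. 0 < Y \<and> Y < ys \<and> \<tau> k Y < T"
    then obtain Y where Y: "0 < Y" "Y < ys" "\<tau> k Y < T" by auto
    then show "\<exists>v\<in>?A. ?f v < T"
      using V_pos[OF Y(1,2)] V_less_v0[OF Y(1,2)] Tk_V[OF Y(1,2) k] by (intro bexI[of _ "V Y"]) auto
  qed
  also have "\<dots> \<longleftrightarrow> (\<exists>Y. 0 < Y \<and> Y < ys \<and> \<tau> k Y = T)"
  proof
    assume "\<exists>Y. 0 < Y \<and> Y < ys \<and> \<tau> k Y < T"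
    then show "\<exists>Y. 0 < Y \<and> Y < ys \<and> \<tau> k Y = T" using k by (auto elim: \<tau>_hits)
  next
    assume "\<exists>Y. 0 < Y \<and> Y < ys \<and> \<tau> k Y = T"
    then obtain Y where "0 < Y" "Y < ys" "\<tau> k Y = T" by auto
    \<comment> \<open>Halving the amplitude lowers \<open>\<tau> k\<close> strictly: the infimum is
      not attained.\<close>
    then show "\<exists>Y. 0 < Y \<and> Y < ys \<and> \<tau> k Y < T"
      using \<tau>_strict_mono[of "Y / 2" Y k] k by (intro exI[of _ "Y / 2"]) auto
  qed
  finally show ?thesis .
qed

section \<open>End states, and the count for end value 0\<close>

lemma force_minus: "force (- y) = - force y"
  by (simp add: force_def)

text \<open>The state \<open>x\<close> of the orbit of amplitude \<open>Y\<close> at the angle \<open>b\<close>.\<close>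

definition X :: "real \<Rightarrow> real \<Rightarrow> real" where
  "X Y b = Y * (cos b * sqrt (R Y \<bar>sin b\<bar>)) + F (Y * sin b)"

text \<open>By uniqueness the orbit built in \<open>oscillation\<close> is the only one with initial
  velocity \<open>V Y\<close>, so its state at \<open>T\<close> decides.\<close>

lemma V_mem_velocities_iff:
  assumes Y: "0 < Y" "Y < ys" and b: "0 \<le> b" "\<Theta> Y b = T"
  shows "V Y \<in> velocities T x \<longleftrightarrow> X Y b = x"
proof -
  obtain y y' where y: "ode T y y'" "y 0 = 0" "y' 0 = V Y" "y T = Y * sin b"
    "y' T = Y * (cos b * sqrt (R Y \<bar>sin b\<bar>))"
    by (rule oscillation[OF Y b])
  have T: "0 \<le> T" using \<Theta>_ge[of Y b] Y b by simp
  show ?thesis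
  proof
    assume "V Y \<in> velocities T x"
    then obtain z z' where z: "ode T z z'" "z 0 = 0" "z' 0 = V Y" "z' T + F (z T) = x"
      by (auto simp: velocities_def)
    have "z T = y T" "z' T = y' T"
      using ode_unique[OF z(1) y(1), of 0 T] z y T by simp_all
    then show "X Y b = x" using z y by (simp add: X_def)
  next
    assume "X Y b = x"
    then show "V Y \<in> velocities T x"
      unfolding velocities_def using y by (intro CollectI exI[of _ y] exI[of _ y']) (simp add: X_def)
  qed
qed

lemma ex_angle:
  assumes "0 \<le> Y" "Y < ys" "0 \<le> T"
  obtains b where "0 \<le> b" "\<Theta> Y b = T"
proof -
  have "\<exists>b\<ge>0. b \<le> T \<and> \<Theta> Y b = T"
    using assms \<Theta>_ge[of Y T] by (intro IVT') (auto intro!: continuous_on_\<Theta> continuous_intros)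
  then show thesis using that by blast
qed

lemma X_add_mult_pi: "X Y (real n * pi + b) = (- 1) ^ n * X Y b"
proof -
  have "(-1::real) ^ n = 1 \<or> (-1::real) ^ n = - 1" by (cases "even n") auto
  moreover have "sin (real n * pi + b) = (-1) ^ n * sin b" "cos (real n * pi + b) = (-1) ^ n * cos b"
    by (simp_all add: sin_add cos_add)
  ultimately show ?thesis by (auto simp: X_def)
qed

text \<open>A vanishing state means \<open>y' = - F y\<close>, and the energy identity then leaves
  \<open>y^2 = (V Y)^2\<close>, so the sine is that of \<open>\<alpha> Y\<close>. The negative
  velocity selects the angle in the second quadrant.\<close>

lemma X_eq_0_iff_half_turn:
  assumes Y: "0 < Y" "Y < ys" and b: "0 \<le> b" "b < pi"
  shows "X Y b = 0 \<longleftrightarrow> b = pi - \<alpha> Y"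
proof
  define s where "s = sin b"
  have s: "0 \<le> s" "s \<le> 1" using b by (auto simp: s_def sin_ge_zero)
  assume "X Y b = 0"
  then have eq: "Y * (cos b * sqrt (R Y s)) = - F (Y * s)" using s by (simp add: X_def s_def)
  have "(Y * (cos b * sqrt (R Y s)))\<^sup>2 = Y\<^sup>2 * (1 - s\<^sup>2) * R Y s"
    using R_pos[of Y s] Y s by (simp add: power_mult_distrib cos_squared_eq s_def)
  also have "\<dots> = (F (Y * s))\<^sup>2 - (Y * s)\<^sup>2 + (V Y)\<^sup>2"
    using R_energy[of Y s] Y s by (simp add: V_sq G_eq)
  finally have "(Y * s)\<^sup>2 = (V Y)\<^sup>2" unfolding eq by simp
  then have "Y * s = V Y" using Y s V_pos[OF Y] by (simp add: power2_eq_iff_nonneg)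
  then have sr: "s = sqrt (R Y 0)" using Y by (simp add: V_def)
  then have "0 < s" using sqrt_R_0_bounds[of Y] Y by simp
  then have "Y * (cos b * sqrt (R Y s)) < 0" unfolding eq using F_strict_mono[of 0 "Y * s"] Y by simp
  then have "cos b < 0" using Y R_pos[of Y s] s by (simp add: mult_less_0_iff zero_less_mult_iff)
  then have "pi / 2 < b" using cos_ge_zero[of b] b by (cases "b \<le> pi / 2") auto
  then have "arcsin (sin (pi - b)) = pi - b" using b by (intro arcsin_sin) auto
  then show "b = pi - \<alpha> Y" using sr by (simp add: \<alpha>_def s_def)
next
  assume b: "b = pi - \<alpha> Y"
  define s where "s = sqrt (R Y 0)"
  have s: "0 < s" "s \<le> 1" "sin b = s" and Ys: "Y * s = V Y"
    using sqrt_R_0_bounds[of Y] Y sin_\<alpha>[of Y] by (auto simp: s_def b V_def)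
  have "(Y * (- cos b * sqrt (R Y s)))\<^sup>2 = Y\<^sup>2 * (1 - s\<^sup>2) * R Y s"
    using R_pos[of Y s] Y s by (simp add: power_mult_distrib cos_squared_eq)
  also have "\<dots> = (F (Y * s))\<^sup>2"
    using R_energy[of Y s] Y s G_eq[of "V Y"] by (simp add: Ys V_sq)
  finally have "(Y * (- cos b * sqrt (R Y s)))\<^sup>2 = (F (Y * s))\<^sup>2" .
  \<comment> \<open>In the second quadrant both sides are nonnegative, so equality of squares
    suffices.\<close>
  moreover have "0 \<le> Y * (- cos b * sqrt (R Y s))"
    using \<alpha>_bounds[of Y] Y R_pos[of Y s] s cos_ge_zero[of "\<alpha> Y"]
    by (intro mult_nonneg_nonneg) (auto simp: b)
  moreover have "0 \<le> F (Y * s)" using F_mono[of 0 "Y * s"] Y s by simp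
  ultimately have "Y * (- cos b * sqrt (R Y s)) = F (Y * s)" by (simp only: power2_eq_iff_nonneg)
  then show "X Y b = 0" using s by (simp add: X_def)
qed

lemma X_eq_0_iff:
  assumes Y: "0 < Y" "Y < ys" and b: "0 \<le> b"
  shows "X Y b = 0 \<longleftrightarrow> (\<exists>k\<ge>1. b = real k * pi - \<alpha> Y)"
proof -
  \<comment> \<open>The number of completed half turns; each only changes the sign of
    \<open>X\<close>.\<close>
  define n where "n = nat \<lfloor>b / pi\<rfloor>"
  define c where "c = b - real n * pi"
  have "0 \<le> b / pi" using b by simp
  then have "real n \<le> b / pi" "b / pi < real n + 1" unfolding n_def by linarith+
  then have c: "0 \<le> c" "c < pi" by (simp_all add: c_def field_simps)
  have bc: "b = real n * pi + c" by (simp add: c_def)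
  have al: "0 < \<alpha> Y" "\<alpha> Y \<le> pi / 2" using \<alpha>_bounds[of Y] Y by auto
  have "X Y b = 0 \<longleftrightarrow> c = pi - \<alpha> Y"
    unfolding bc X_add_mult_pi using X_eq_0_iff_half_turn[OF Y c] by simp
  also have "\<dots> \<longleftrightarrow> (\<exists>k\<ge>1. b = real k * pi - \<alpha> Y)"
  proof
    assume "c = pi - \<alpha> Y"
    then show "\<exists>k\<ge>1. b = real k * pi - \<alpha> Y" unfolding bc by (intro exI[of _ "Suc n"]) (simp add: algebra_simps)
  next
    assume "\<exists>k\<ge>1. b = real k * pi - \<alpha> Y"
    then obtain k where k: "1 \<le> k" "real n * pi + c = real k * pi - \<alpha> Y" using bc by auto
    have "(real k - real n) * pi = c + \<alpha> Y" using k(2) by (simp add: algebra_simps)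
    moreover have "0 < c + \<alpha> Y" "c + \<alpha> Y < 2 * pi" using al c pi_gt_zero by linarith+
    \<comment> \<open>An integer strictly between 0 and 2 is 1.\<close>
    ultimately have "0 < (real k - real n) * pi" "(real k - real n) * pi < 2 * pi" by simp_all
    then have "0 < real k - real n" "real k - real n < 2"
      using pi_gt_zero by (simp_all add: zero_less_mult_iff)
    then have "k = Suc n" by linarith
    then show "c = pi - \<alpha> Y" using k(2) by (simp add: algebra_simps)
  qed
  finally show ?thesis .
qed

lemma V_mem_velocities_0_iff:
  assumes Y: "0 < Y" "Y < ys" and T: "0 \<le> T"
  shows "V Y \<in> velocities T 0 \<longleftrightarrow> (\<exists>k\<ge>1. \<tau> k Y = T)"
proof -
  obtain b where b: "0 \<le> b" "\<Theta> Y b = T" by (rule ex_angle[of Y T]) (use Y T in simp_all)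
  have "b = real k * pi - \<alpha> Y \<longleftrightarrow> \<tau> k Y = T" if "1 \<le> k" for k
  proof -
    have "0 \<le> real k * pi - \<alpha> Y" using k_pi_minus_\<alpha>(2)[of Y k] Y that by simp
    then show ?thesis
      using \<Theta>_strict_mono[of Y b "real k * pi - \<alpha> Y"] \<Theta>_strict_mono[of Y "real k * pi - \<alpha> Y" b] b Y
      by (cases b "real k * pi - \<alpha> Y" rule: linorder_cases) (auto simp: \<tau>_def)
  qed
  then show ?thesis
    unfolding V_mem_velocities_iff[OF Y b] X_eq_0_iff[OF Y b(1)] by blast
qed

text \<open>A zero of \<open>y'\<close> would put the orbit on a saddle.\<close>

lemma outer_orbit:
  assumes o: "ode T y y'" "y 0 = 0" and s: "v0 \<eta> \<le> y' 0" and t: "t \<in> {0..T}"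
  shows "0 < y' t" "0 \<le> y t"
proof -
  have nz: "y' r \<noteq> 0" if r: "r \<in> {0..T}" for r
  proof
    assume z: "y' r = 0"
    then have G: "G \<eta> (y r) = - (y' 0)\<^sup>2" using ode_energy[OF o r] by simp
    moreover have "(v0 \<eta>)\<^sup>2 \<le> (y' 0)\<^sup>2" using s v0_pos by (intro power_mono) auto
    ultimately have "G \<eta> \<bar>y r\<bar> = G \<eta> ys" using G_ge_saddle[of "y r"] by (simp add: v0_sq)
    then have yr: "\<bar>y r\<bar> = ys" by (simp only: G_eq_saddle_iff[OF abs_ge_zero])
    then have "force (y r) = 0"
      using force_ys force_minus[of ys] by (cases "y r \<ge> 0") (auto simp: minus_equation_iff[of _ ys])
    \<comment> \<open>The constant saddle orbit agrees with the given one at time \<open>r\<close>;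
      uniqueness run back to time 0 contradicts \<open>y 0 = 0\<close>.\<close>
    then have "ode T (\<lambda>_. y r) (\<lambda>_. 0)" by (simp add: ode_def)
    from ode_unique(1)[OF o(1) this r, of 0] z o(2) t have "y r = 0" by simp
    then show False using yr ys_pos by simp
  qed
  have pos: "0 < y' r" if r: "r \<in> {0..T}" for r
  proof (rule ccontr)
    assume "\<not> 0 < y' r"
    moreover have "0 < y' 0" using s v0_pos by simp
    ultimately have "\<exists>x\<ge>0. x \<le> r \<and> y' x = 0"
      using r by (intro IVT2') (auto intro: continuous_on_subset[OF ode_continuous(2)[OF o(1)]])
    then show False using nz r by auto
  qed
  show "0 < y' t" by (rule pos[OF t])
  have "y 0 \<le> y t"
  proof (rule DERIV_nonneg_imp_increasing_open[of 0 t y])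
    fix x assume x: "0 < x" "x < t"
    then have "(y has_real_derivative y' x) (at x)"
      using odeD(1)[OF o(1), of x] t by (simp add: at_within_Icc_at)
    then show "\<exists>d. (y has_real_derivative d) (at x) \<and> 0 \<le> d"
      using pos[of x] x t by (intro exI[of _ "y' x"]) auto
  qed (use t in \<open>auto intro: continuous_on_subset[OF ode_continuous(1)[OF o(1)]]\<close>)
  then show "0 \<le> y t" using o by simp
qed

text \<open>The end velocity is positive and \<open>F (y T)\<close> is nonnegative. This keeps outer
  orbits of positive initial velocity away from end values at most 0.\<close>

lemma velocities_outer_pos:
  assumes "s \<in> velocities T x" "v0 \<eta> \<le> s" "0 \<le> T"
  shows "0 < x"
proof -
  obtain y y' where y: "ode T y y'" "y 0 = 0" "y' 0 = s" "y' T + F (y T) = x"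
    using assms by (auto simp: velocities_def)
  have "0 < y' T" "0 \<le> y T" using outer_orbit[OF y(1,2), of T] y assms by auto
  then show ?thesis using y(4) F_mono[of 0 "y T"] by simp
qed

lemma zero_mem_velocities: "0 \<in> velocities T 0"
proof -
  have "ode T (\<lambda>_. 0) (\<lambda>_. 0)" by (simp add: ode_def force_def)
  then show ?thesis unfolding velocities_def by force
qed

text \<open>Velocity 0 is the rest state, positive velocities are of the form \<open>V Y\<close>
  because those from \<open>v0 \<eta>\<close> on are excluded, and reflection gives the negative
  ones.\<close>

lemma velocities_0:
  assumes T: "0 \<le> T"
  shows "velocities T 0 = {0} \<union> V ` {Y. 0 < Y \<and> Y < ys \<and> (\<exists>k\<ge>1. \<tau> k Y = T)}
     \<union> (\<lambda>Y. - V Y) ` {Y. 0 < Y \<and> Y < ys \<and> (\<exists>k\<ge>1. \<tau> k Y = T)}"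
proof -
  define P where "P = {Y. 0 < Y \<and> Y < ys \<and> (\<exists>k\<ge>1. \<tau> k Y = T)}"
  have sym: "- s \<in> velocities T 0" if "s \<in> velocities T 0" for s
    using velocities_minus[of T 0] that by auto
  have pos: "s \<in> V ` P" if "s \<in> velocities T 0" "0 < s" for s
  proof -
    have "s < v0 \<eta>" using velocities_outer_pos[OF that(1) _ T] by (cases "s < v0 \<eta>") auto
    with that obtain Y where Y: "0 < Y" "Y < ys" "V Y = s" using V_surj[of s] by metis
    then show ?thesis using V_mem_velocities_0_iff[OF Y(1,2) T] that by (auto simp: P_def)
  qed
  show ?thesis
    unfolding P_def[symmetric]
  proof (intro equalityI subsetI)
    fix s assume s: "s \<in> velocities T 0"
    show "s \<in> {0} \<union> V ` P \<union> (\<lambda>Y. - V Y) ` P"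
    proof (cases s "0::real" rule: linorder_cases)
      case less
      then obtain Y where "Y \<in> P" "- s = V Y" using pos[OF sym[OF s]] by auto
      then have "s \<in> (\<lambda>Y. - V Y) ` P" by (intro image_eqI[of _ _ Y]) auto
      then show ?thesis by blast
    next
      case greater
      then have "s \<in> V ` P" using pos[OF s] by simp
      then show ?thesis by blast
    qed simp
  next
    fix s assume "s \<in> {0} \<union> V ` P \<union> (\<lambda>Y. - V Y) ` P"
    then show "s \<in> velocities T 0"
      using zero_mem_velocities V_mem_velocities_0_iff[OF _ _ T] sym by (auto simp: P_def)
  qed
qed

text \<open>The admissible indices form a segment \<open>{1..K}\<close>. Each index has exactly one
  amplitude, distinct indices have distinct ones, and each amplitude contributes two opposite
  velocities; the rest state contributes 1.\<close>

lemma card_velocities_0: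
  assumes T: "0 < T"
  shows "finite (velocities T 0)"
    and "enat (card (velocities T 0)) = 1 + 2 * (SUP k\<in>{k::nat. 1 \<le> k \<and> Tk0 \<eta> k < T}. enat k)"
proof -
  define N where "N = {k::nat. 1 \<le> k \<and> Tk0 \<eta> k < T}"
  define P where "P = {Y. 0 < Y \<and> Y < ys \<and> (\<exists>k\<ge>1. \<tau> k Y = T)}"
  have hit: "\<exists>Y. 0 < Y \<and> Y < ys \<and> \<tau> k Y = T" if "k \<in> N" for k
    using that Tk0_less_iff[of k T] by (simp add: N_def)
  have bound: "real k \<le> T" if "k \<in> N" for k
    using hit[OF that] \<tau>_ge[of _ k] that by (force simp: N_def)
  \<comment> \<open>At the amplitude with \<open>\<tau> l Y = T\<close> the earlier time
    \<open>\<tau> k Y\<close> is below \<open>T\<close>, and a larger amplitude brings it to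
    \<open>T\<close>.\<close>
  have down: "k \<in> N" if l: "l \<in> N" and k: "1 \<le> k" "k \<le> l" for k l
  proof (cases "k = l")
    case False
    obtain Y where Y: "0 < Y" "Y < ys" "\<tau> l Y = T" using hit[OF l] by blast
    then have "\<tau> k Y < T" using \<tau>_less_Suc[of Y k l] k False by simp
    then obtain Z where "0 < Z" "Z < ys" "\<tau> k Z = T" by (rule \<tau>_hits[OF Y(1,2) k(1)])
    then show ?thesis using Tk0_less_iff[of k T] k by (auto simp: N_def)
  qed (use l in simp)
  \<comment> \<open>\<open>\<tau> k Y\<close> is at least \<open>k\<close>, so no index exceeds
    \<open>T\<close>.\<close>
  have finN: "finite N"
    by (rule finite_subset[of _ "{..nat \<lfloor>T\<rfloor>}"]) (use bound in \<open>auto simp: le_nat_floor\<close>)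
  define K where "K = card N"
  have N: "N = {1..K}"
  proof (cases "N = {}")
    case False
    have "N = {1..Max N}"
      using down[OF Max_in[OF finN False]] Max_ge[OF finN] by (auto simp: N_def)
    then show ?thesis unfolding K_def by (metis card_atLeastAtMost diff_Suc_1)
  qed (simp add: K_def)
  define f where "f k = (SOME Y. 0 < Y \<and> Y < ys \<and> \<tau> k Y = T)" for k
  have f: "0 < f k \<and> f k < ys \<and> \<tau> k (f k) = T" if "k \<in> N" for k
    unfolding f_def by (rule someI_ex[OF hit[OF that]])
  have fimg: "f ` N = P"
  proof (intro equalityI subsetI)
    fix Y assume "Y \<in> f ` N"
    then show "Y \<in> P" using f by (auto simp: P_def N_def)
  next
    fix Y assume "Y \<in> P"
    then obtain k where k: "0 < Y" "Y < ys" "1 \<le> k" "\<tau> k Y = T" by (auto simp: P_def)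
    then have "k \<in> N" using Tk0_less_iff[of k T] by (auto simp: N_def)
    moreover have "f k = Y"
      using f[OF \<open>k \<in> N\<close>] k \<tau>_strict_mono[of Y "f k" k] \<tau>_strict_mono[of "f k" Y k]
      by (cases "f k" Y rule: linorder_cases) auto
    ultimately show "Y \<in> f ` N" by blast
  qed
  have finj: "inj_on f N"
  proof (rule linorder_inj_onI)
    fix k l assume "k < l" "k \<in> N" "l \<in> N"
    then show "f k \<noteq> f l" using f[of k] f[of l] \<tau>_less_Suc[of "f k" k l] by (auto simp: N_def)
  qed auto
  have finP: "finite P" and cardP: "card P = K"
    using fimg finN card_image[OF finj] by (auto simp: K_def)
  have PV: "0 < V Y" if "Y \<in> P" for Y using that V_pos by (auto simp: P_def)
  have injV: "inj_on V P" using V_inject by (auto simp: inj_on_def P_def)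
  then have injV': "inj_on (\<lambda>Y. - V Y) P" by (auto simp: inj_on_def)
  have vel: "velocities T 0 = {0} \<union> V ` P \<union> (\<lambda>Y. - V Y) ` P"
    using velocities_0[of T] T by (simp add: P_def)
  show "finite (velocities T 0)" unfolding vel using finP by simp
  have "card (velocities T 0) = card ({0} \<union> V ` P) + card ((\<lambda>Y. - V Y) ` P)"
    unfolding vel
  proof (intro card_Un_disjoint)
    show "({0} \<union> V ` P) \<inter> (\<lambda>Y. - V Y) ` P = {}"
    proof (rule equals0I, elim IntE)
      fix s assume s: "s \<in> {0} \<union> V ` P" "s \<in> (\<lambda>Y. - V Y) ` P"
      have "0 \<le> s" using s(1) less_imp_le[OF PV] by auto
      moreover have "s < 0" using s(2) PV by auto
      ultimately show False by simp
    qed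
  qed (use finP in auto)
  also have "card ({0} \<union> V ` P) = card {0::real} + card (V ` P)"
    using finP by (intro card_Un_disjoint) (auto dest: PV)
  finally have "card (velocities T 0) = 1 + 2 * K"
    by (simp add: card_image[OF injV] card_image[OF injV'] cardP)
  then show "enat (card (velocities T 0)) = 1 + 2 * (SUP k\<in>{k::nat. 1 \<le> k \<and> Tk0 \<eta> k < T}. enat k)"
    unfolding N_def[symmetric] N SUP_enat_atLeastAtMost
    by (simp add: one_enat_def numeral_eq_enat)
qed

section \<open>Many solutions below the threshold\<close>

lemma continuous_on_X:
  fixes S :: "real set"
  assumes "continuous_on S f" "continuous_on S g"
  shows "continuous_on S (\<lambda>x. X (f x) (g x))"
  unfolding X_def by (intro continuous_intros continuous_on_R assms) auto

text \<open>The amplitude \<open>\<psi> b\<close> is chosen so that the angle at time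
  \<open>T\<close> is exactly \<open>b\<close>. Along the resulting curve of end states the
  intermediate value theorem applies once in each full turn.\<close>

lemma many_velocities:
  assumes x: "0 \<le> x" "x < xs"
  shows "\<exists>Tstar>0. \<forall>T\<ge>Tstar. \<exists>S\<subseteq>velocities T x. finite S \<and> card S = n"
proof -
  have "(F \<longlongrightarrow> F ys) (at_left ys)"
    using DERIV_isCont[OF DERIV_F, of ys] by (simp add: isCont_def filterlim_at_split)
  then have "\<forall>\<^sub>F Y in at_left ys. x < F Y" using x by (intro order_tendstoD(1)) (auto simp: F_ys)
  moreover have "\<forall>\<^sub>F Y in at_left ys. Y \<in> {0<..<ys}" using ys_pos by (rule eventually_at_left_real)
  ultimately have "\<forall>\<^sub>F Y in at_left ys. x < F Y \<and> Y \<in> {0<..<ys}" by eventually_elim simp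
  \<comment> \<open>\<open>F\<close> tends to \<open>xs\<close> at \<open>ys\<close>, so amplitudes
    from \<open>Y1\<close> on have \<open>F Y > x\<close>.\<close>
  then obtain Y1 where Y1: "x < F Y1" "0 < Y1" "Y1 < ys"
    using eventually_happens'[of "at_left ys"] by auto
  show ?thesis
  \<comment> \<open>By this time the orbit of amplitude \<open>Y1\<close> has made
    \<open>n + 1\<close> full turns, so every angle in \<open>B\<close> is attained at
    \<open>T\<close> by some amplitude from \<open>Y1\<close> on.\<close>
  proof (intro exI[of _ "\<Theta> Y1 (2 * pi * real (Suc n))"] conjI allI impI)
    show "0 < \<Theta> Y1 (2 * pi * real (Suc n))" using \<Theta>_strict_mono[of Y1 0 "2 * pi * real (Suc n)"] Y1 by simp
    fix T assume T: "\<Theta> Y1 (2 * pi * real (Suc n)) \<le> T"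
    obtain W where W: "0 \<le> W" "W < ys" "\<And>Y. W \<le> Y \<Longrightarrow> Y < ys \<Longrightarrow> T \<le> \<Theta> Y (pi / 2)"
      by (rule \<Theta>_diverges[of T]) blast
    define B where "B = {pi / 2..2 * pi * real (Suc n)}"
    have Bpos: "0 < b" if "b \<in> B" for b using that pi_gt_zero by (auto simp: B_def intro: less_le_trans[of 0 "pi / 2"])
    define \<psi> where "\<psi> b = (SOME Y. Y1 \<le> Y \<and> Y < ys \<and> \<Theta> Y b = T)" for b
    have \<psi>: "Y1 \<le> \<psi> b \<and> \<psi> b < ys \<and> \<Theta> (\<psi> b) b = T" if b: "b \<in> B" for b
      unfolding \<psi>_def
    proof (rule someI_ex[of "\<lambda>Y. Y1 \<le> Y \<and> Y < ys \<and> \<Theta> Y b = T"])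
      define Z where "Z = max W Y1"
      have Z: "Y1 \<le> Z" "Z < ys" "W \<le> Z" using W Y1 by (auto simp: Z_def)
      have "\<Theta> Y1 b \<le> T"
        using T b Bpos[OF b] Y1 \<Theta>_diff_ge[of Y1 b "2 * pi * real (Suc n)"] by (auto simp: B_def)
      moreover have "T \<le> \<Theta> Z b"
        using W(3)[of Z] Z Y1 b \<Theta>_diff_ge[of Z "pi / 2" b] by (auto simp: B_def)
      ultimately have "\<exists>Y\<ge>Y1. Y \<le> Z \<and> \<Theta> Y b = T"
        using Z Y1 Bpos[OF b] by (intro IVT') (auto intro!: continuous_on_\<Theta> continuous_intros)
      then show "\<exists>Y. Y1 \<le> Y \<and> Y < ys \<and> \<Theta> Y b = T" using Z by auto
    qed
    \<comment> \<open>\<open>\<Theta>\<close> increases strictly in the amplitude, so comparing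
      \<open>\<psi> b\<close> with \<open>a\<close> amounts to comparing \<open>T\<close> with
      \<open>\<Theta> a b\<close>, which is continuous in \<open>b\<close>.\<close>
    have \<psi>_cont: "continuous_on B \<psi>"
      unfolding continuous_on_def
    proof
      fix b0 assume b0: "b0 \<in> B"
      have ev: "\<forall>\<^sub>F b in at b0 within B. b \<in> B"
        unfolding eventually_at_filter by (intro always_eventually) auto
      have \<Theta>_tendsto: "(\<Theta> a \<longlongrightarrow> \<Theta> a b0) (at b0 within B)" if "0 \<le> a" "a < ys" for a
      proof -
        have "continuous_on B (\<Theta> a)"
          using that Bpos by (intro continuous_on_\<Theta> continuous_intros) (auto intro: less_imp_le)
        then show ?thesis using b0 by (simp add: continuous_on_def)
      qed
      show "(\<psi> \<longlongrightarrow> \<psi> b0) (at b0 within B)"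
      proof (rule order_tendstoI)
        fix a assume a: "a < \<psi> b0"
        show "\<forall>\<^sub>F b in at b0 within B. a < \<psi> b"
        proof (cases "a < Y1")
          case True
          show ?thesis using ev by eventually_elim (use True \<psi> in \<open>auto intro: less_le_trans\<close>)
        next
          case False
          then have a': "0 \<le> a" "a < ys" using a Y1 \<psi>[OF b0] by auto
          have "\<Theta> a b0 < T" using \<Theta>_strict_mono_amplitude[of a "\<psi> b0" b0] a a' \<psi>[OF b0] Bpos[OF b0] by simp
          then have "\<forall>\<^sub>F b in at b0 within B. \<Theta> a b < T" by (rule order_tendstoD(2)[OF \<Theta>_tendsto[OF a']])
          with ev show ?thesis
          proof eventually_elim
            case (elim b)
            then show ?case using \<psi>[OF elim(1)] \<Theta>_strict_mono_amplitude[of "\<psi> b" a b] a' Bpos[OF elim(1)] Y1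
              by (cases a "\<psi> b" rule: linorder_cases) auto
          qed
        qed
      next
        fix a assume a: "\<psi> b0 < a"
        show "\<forall>\<^sub>F b in at b0 within B. \<psi> b < a"
        proof (cases "ys \<le> a")
          case True
          show ?thesis using ev by eventually_elim (use True \<psi> in \<open>auto intro: less_le_trans\<close>)
        next
          case False
          then have a': "0 \<le> a" "a < ys" using a Y1 \<psi>[OF b0] by auto
          have "T < \<Theta> a b0" using \<Theta>_strict_mono_amplitude[of "\<psi> b0" a b0] a a' \<psi>[OF b0] Bpos[OF b0] Y1 by simp
          then have "\<forall>\<^sub>F b in at b0 within B. T < \<Theta> a b" by (rule order_tendstoD(1)[OF \<Theta>_tendsto[OF a']])
          with ev show ?thesis
          proof eventually_elim
            case (elim b)
            then show ?case using \<psi>[OF elim(1)] \<Theta>_strict_mono_amplitude[of a "\<psi> b" b] a' Bpos[OF elim(1)] Y1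
              by (cases a "\<psi> b" rule: linorder_cases) auto
          qed
        qed
      qed
    qed
    have ex: "\<exists>b. b \<in> B \<and> pi / 2 + real k * (2 * pi) \<le> b \<and> b \<le> pi + real k * (2 * pi) \<and> X (\<psi> b) b = x" if k: "k < n" for k
    proof -
      define l u where "l = pi / 2 + real k * (2 * pi)" and "u = pi + real k * (2 * pi)"
      have "real k * (2 * pi) \<le> real n * (2 * pi)" using k by (intro mult_right_mono) auto
      moreover have "0 \<le> real k * (2 * pi)" by simp
      moreover have "2 * pi * real (Suc n) = real n * (2 * pi) + 2 * pi" by (simp add: algebra_simps)
      ultimately have lu: "pi / 2 \<le> l" "l \<le> u" "u \<le> 2 * pi * real (Suc n)"
        using pi_gt_zero unfolding l_def u_def by linarith+
      then have sub: "{l..u} \<subseteq> B" "l \<in> B" "u \<in> B" by (auto simp: B_def)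
      have trig: "sin l = 1" "cos l = 0" "sin u = 0" "cos u = - 1"
      proof -
        have "real k * (2 * pi) = 2 * real k * pi" by simp
        then have "sin (real k * (2 * pi)) = 0" "cos (real k * (2 * pi)) = 1"
          using sin_2npi[of k] cos_2npi[of k] by (simp_all only:)
        then show "sin l = 1" "cos l = 0" "sin u = 0" "cos u = - 1"
          by (simp_all add: l_def u_def sin_add cos_add)
      qed
      \<comment> \<open>At \<open>l\<close> the orbit turns, with state \<open>F (\<psi> l)\<close>;
        at \<open>u\<close> it crosses \<open>y = 0\<close> with negative velocity.\<close>
      have "x \<le> X (\<psi> l) l" using trig \<psi>[OF sub(2)] Y1 F_mono[of Y1 "\<psi> l"] by (simp add: X_def)
      moreover have "X (\<psi> u) u \<le> x"
      proof -
        have "X (\<psi> u) u \<le> 0" using trig \<psi>[OF sub(3)] Y1 R_pos[of "\<psi> u" 0] by (simp add: X_def)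
        then show ?thesis using x by simp
      qed
      ultimately have "\<exists>b\<ge>l. b \<le> u \<and> X (\<psi> b) b = x"
        using lu continuous_on_subset[OF \<psi>_cont sub(1)]
        by (intro IVT2' continuous_on_X continuous_on_id) auto
      then show ?thesis using sub by (auto simp: l_def u_def)
    qed
    define \<beta> where "\<beta> k = (SOME b. b \<in> B \<and> pi / 2 + real k * (2 * pi) \<le> b \<and> b \<le> pi + real k * (2 * pi) \<and> X (\<psi> b) b = x)" for k
    have \<beta>: "\<beta> k \<in> B" "pi / 2 + real k * (2 * pi) \<le> \<beta> k" "\<beta> k \<le> pi + real k * (2 * pi)" "X (\<psi> (\<beta> k)) (\<beta> k) = x"
      if "k < n" for k
      using someI_ex[OF ex[OF that]] unfolding \<beta>_def by blast+
    have inj: "inj_on (\<lambda>k. V (\<psi> (\<beta> k))) {..<n}"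
    proof (rule linorder_inj_onI)
      fix k l assume kl: "k < l" "k \<in> {..<n}" "l \<in> {..<n}"
      have "(real k + 1) * (2 * pi) \<le> real l * (2 * pi)" using kl by (intro mult_right_mono) auto
      moreover have "(real k + 1) * (2 * pi) = real k * (2 * pi) + 2 * pi" by (simp add: algebra_simps)
      moreover have "\<beta> k \<le> pi + real k * (2 * pi)" "pi / 2 + real l * (2 * pi) \<le> \<beta> l"
        using \<beta>(3)[of k] \<beta>(2)[of l] kl by simp_all
      ultimately have less: "\<beta> k < \<beta> l" using pi_gt_zero by linarith
      show "V (\<psi> (\<beta> k)) \<noteq> V (\<psi> (\<beta> l))"
      proof
        assume eq: "V (\<psi> (\<beta> k)) = V (\<psi> (\<beta> l))"
        have mem: "\<beta> k \<in> B" "\<beta> l \<in> B" using \<beta>(1) kl by simp_all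
        have pos: "0 < \<psi> (\<beta> k)" "\<psi> (\<beta> k) < ys" "0 < \<psi> (\<beta> l)" "\<psi> (\<beta> l) < ys"
          using \<psi>[OF mem(1)] \<psi>[OF mem(2)] Y1 by simp_all
        \<comment> \<open>Equal velocities mean equal amplitudes, but one orbit cannot have two
          angles at time \<open>T\<close>.\<close>
        then have "\<psi> (\<beta> k) = \<psi> (\<beta> l)" using eq by (rule V_inject)
        then show False
          using \<Theta>_strict_mono[of "\<psi> (\<beta> k)" "\<beta> k" "\<beta> l"] less \<psi>[OF mem(1)] \<psi>[OF mem(2)] pos Bpos[OF mem(1)]
          by simp
      qed
    qed auto
    have "V (\<psi> (\<beta> k)) \<in> velocities T x" if "k < n" for k
      using \<psi>[OF \<beta>(1)[OF that]] Y1 Bpos[OF \<beta>(1)[OF that]] \<beta>(4)[OF that]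
      by (subst V_mem_velocities_iff[where b = "\<beta> k"]) auto
    then show "\<exists>S\<subseteq>velocities T x. finite S \<and> card S = n"
      using card_image[OF inj] by (intro exI[of _ "(\<lambda>k. V (\<psi> (\<beta> k))) ` {..<n}"]) auto
  qed
qed

subsection \<open>Orbits outside the separatrices\<close>

text \<open>With positive energy expression the velocity is a function of position, so
  \<open>y' = sqrt (G \<eta> y + c)\<close> is separable; differentiating it gives the
  force.\<close>

lemma energy_solution:
  assumes Y: "0 \<le> Y" and pos: "\<And>z. z \<in> {0..Y} \<Longrightarrow> 0 < G \<eta> z + c"
    and T: "integral {0..Y} (\<lambda>z. 1 / sqrt (G \<eta> z + c)) = T"
  obtains y y' where "ode T y y'" "y 0 = 0" "y T = Y" "y' T = sqrt (G \<eta> Y + c)"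
proof -
  define g where "g z = sqrt (G \<eta> z + c)" for z
  have cont: "continuous_on {0..Y} g" unfolding g_def by (intro continuous_intros)
  have gpos: "0 < g z" if "z \<in> {0..Y}" for z using pos[OF that] by (simp add: g_def)
  have T': "integral {0..Y} (\<lambda>z. 1 / g z) = T" using T by (simp add: g_def)
  obtain p where p: "p 0 = 0" "p T = Y" "p ` {0..T} \<subseteq> {0..Y}"
    "\<And>t. t \<in> {0..T} \<Longrightarrow> (p has_real_derivative g (p t)) (at t within {0..T})"
    by (rule separable_ode_solution[OF Y cont gpos T']) blast+
  show thesis
  proof (rule that[of p "\<lambda>t. g (p t)"])
    show "ode T p (\<lambda>t. g (p t))"
      unfolding ode_def
    proof (intro ballI conjI)
      fix t assume t: "t \<in> {0..T}"
      show "(p has_real_derivative g (p t)) (at t within {0..T})" by (rule p(4)[OF t])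
      have pt: "p t \<in> {0..Y}" using p(3) t by blast
      have "(g has_real_derivative force (p t) / g (p t)) (at (p t))"
        unfolding g_def using pos[OF pt] by (auto intro!: derivative_eq_intros DERIV_G simp: divide_simps)
      from DERIV_chain2[OF this p(4)[OF t]]
      show "((\<lambda>t. g (p t)) has_real_derivative force (p t)) (at t within {0..T})"
        using gpos[OF pt] by simp
    qed
  qed (use p in \<open>simp_all add: g_def\<close>)
qed

text \<open>Converse to \<open>energy_solution\<close>: every position up to \<open>y T\<close> is
  visited with positive velocity, and \<open>P (y t) - t\<close> is constant.\<close>

lemma outer_time_integral:
  assumes o: "ode T y y'" "y 0 = 0" and s: "v0 \<eta> \<le> y' 0" and T: "0 \<le> T"
  shows "\<And>z. z \<in> {0..y T} \<Longrightarrow> 0 < G \<eta> z + (y' 0)\<^sup>2"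
    and "integral {0..y T} (\<lambda>z. 1 / sqrt (G \<eta> z + (y' 0)\<^sup>2)) = T"
proof -
  let ?h = "\<lambda>z. 1 / sqrt (G \<eta> z + (y' 0)\<^sup>2)"
  have mono: "y t \<le> y T" if t: "t \<in> {0..T}" for t
  proof (rule DERIV_nonneg_imp_increasing_open[of t T y])
    fix x assume x: "t < x" "x < T"
    then have "(y has_real_derivative y' x) (at x)"
      using odeD(1)[OF o(1), of x] t by (simp add: at_within_Icc_at)
    then show "\<exists>d. (y has_real_derivative d) (at x) \<and> 0 \<le> d"
      using outer_orbit(1)[OF o s, of x] x t by (intro exI[of _ "y' x"]) auto
  qed (use t in \<open>auto intro: continuous_on_subset[OF ode_continuous(1)[OF o(1)]]\<close>)
  have img: "y ` {0..T} \<subseteq> {0..y T}" using mono outer_orbit(2)[OF o s] by auto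
  show pos: "0 < G \<eta> z + (y' 0)\<^sup>2" if z: "z \<in> {0..y T}" for z
  proof -
    have "\<exists>t\<ge>0. t \<le> T \<and> y t = z"
      using z o(2) T ode_continuous(1)[OF o(1)] by (intro IVT') auto
    then obtain t where t: "t \<in> {0..T}" "y t = z" by auto
    then have "0 < (y' t)\<^sup>2" using outer_orbit(1)[OF o s t(1)] by simp
    then show ?thesis using ode_energy[OF o t(1)] t(2) by simp
  qed
  have cont: "continuous_on {0..y T} ?h"
  proof (intro continuous_intros ballI)
    show "sqrt (G \<eta> z + (y' 0)\<^sup>2) \<noteq> 0" if "z \<in> {0..y T}" for z using pos[OF that] by simp
  qed
  define P where "P z = integral {0..z} ?h" for z
  have "((\<lambda>t. P (y t) - t) has_real_derivative 0) (at t within {0..T})" if t: "t \<in> {0..T}" for t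
  proof -
    have "(P has_real_derivative ?h (y t)) (at (y t) within {0..y T})"
      unfolding P_def using img t by (intro integral_has_real_derivative cont) blast
    then have "(P has_real_derivative ?h (y t)) (at (y t) within y ` {0..T})"
      by (rule has_field_derivative_subset[OF _ img])
    from DERIV_image_chain[OF this odeD(1)[OF o(1) t]]
    have "((\<lambda>t. P (y t)) has_real_derivative ?h (y t) * y' t) (at t within {0..T})" by (simp add: o_def)
    moreover have "sqrt (G \<eta> (y t) + (y' 0)\<^sup>2) = y' t"
      using ode_energy[OF o t] outer_orbit(1)[OF o s t] by (metis less_imp_le real_sqrt_abs abs_of_nonneg)
    ultimately show ?thesis
      using outer_orbit(1)[OF o s t] by (auto intro!: derivative_eq_intros)
  qed
  from has_field_derivative_zero_constant[OF convex_real_interval(5) this]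
  obtain c where "\<And>t. t \<in> {0..T} \<Longrightarrow> P (y t) - t = c" by blast
  from this[of 0] this[of T] show "integral {0..y T} ?h = T" using T o(2) by (simp add: P_def)
qed

section \<open>Uniqueness and existence at or above the threshold\<close>

lemma outer_orbit_mono:
  assumes o: "ode T y y'" "y 0 = 0" and o2: "ode T z z'" "z 0 = 0"
    and s: "v0 \<eta> \<le> y' 0" "y' 0 < z' 0" and T: "0 < T"
  shows "y T < z T"
proof (rule ccontr)
  assume "\<not> y T < z T"
  then have le: "z T \<le> y T" by simp
  have s2: "v0 \<eta> \<le> z' 0" using s by simp
  note P1 = outer_time_integral[OF o s(1) less_imp_le[OF T]]
  note P2 = outer_time_integral[OF o2 s2 less_imp_le[OF T]]
  have zT: "0 < z T"
    using P2(2) outer_orbit(2)[OF o2 s2, of T] T by (cases "z T = 0") auto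
  have sq: "(y' 0)\<^sup>2 < (z' 0)\<^sup>2" using s v0_pos by (intro power_strict_mono) auto
  have cont: "continuous_on {0..b} (\<lambda>x. 1 / sqrt (G \<eta> x + c))" if "\<And>x. x \<in> {0..b} \<Longrightarrow> 0 < G \<eta> x + c" for b c
    using that by (intro continuous_intros) (metis less_irrefl real_sqrt_gt_zero)
  have c1: "continuous_on {0..y T} (\<lambda>x. 1 / sqrt (G \<eta> x + (y' 0)\<^sup>2))" using P1(1) by (rule cont)
  \<comment> \<open>The slower orbit would need more time than the faster one to come at least as
    far, yet both times equal \<open>T\<close>.\<close>
  have "integral {0..z T} (\<lambda>x. 1 / sqrt (G \<eta> x + (z' 0)\<^sup>2)) < integral {0..z T} (\<lambda>x. 1 / sqrt (G \<eta> x + (y' 0)\<^sup>2))"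
  proof (rule integral_less_real)
    show "continuous_on {0..z T} (\<lambda>x. 1 / sqrt (G \<eta> x + (z' 0)\<^sup>2))" using P2(1) by (rule cont)
    show "continuous_on {0..z T} (\<lambda>x. 1 / sqrt (G \<eta> x + (y' 0)\<^sup>2))"
      using c1 le by (auto intro: continuous_on_subset)
    show "1 / sqrt (G \<eta> x + (z' 0)\<^sup>2) < 1 / sqrt (G \<eta> x + (y' 0)\<^sup>2)" if "x \<in> {0<..<z T}" for x
      using P1(1)[of x] P2(1)[of x] that le sq by (intro divide_strict_left_mono mult_pos_pos) auto
  qed (use zT in simp)
  also have "\<dots> \<le> integral {0..y T} (\<lambda>x. 1 / sqrt (G \<eta> x + (y' 0)\<^sup>2))"
    using le c1 P1(1)
    by (intro integral_subset_le integrable_continuous_real) (auto intro: continuous_on_subset less_imp_le)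
  finally show False using P1(2) P2(2) by simp
qed

text \<open>With initial speed below \<open>v0 \<eta>\<close> an orbit cannot cross
  \<open>\<bar>y\<bar> = ys\<close>, where its squared velocity would be negative; but for
  \<open>xs \<le> x\<close> and \<open>y\<close> in \<open>{0..ys}\<close> the value
  \<open>level x y\<close> is at least \<open>(v0 \<eta>)^2\<close>. Velocities up to
  \<open>- v0 \<eta>\<close> give a negative end value.\<close>

lemma velocities_ge_v0:
  assumes s: "s \<in> velocities T x" and x: "xs \<le> x" and T: "0 \<le> T"
  shows "v0 \<eta> \<le> s"
proof (rule ccontr)
  assume "\<not> v0 \<eta> \<le> s"
  then have less: "s < v0 \<eta>" by simp
  have "\<not> v0 \<eta> \<le> - s"
  proof
    assume le: "v0 \<eta> \<le> - s"
    have "- s \<in> velocities T (- x)" using s by (simp add: velocities_minus)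
    from velocities_outer_pos[OF this le T] show False using x xs_pos by simp
  qed
  with less have "s\<^sup>2 < (v0 \<eta>)\<^sup>2" using v0_pos by (intro power2_strict_mono) auto
  obtain y y' where y: "ode T y y'" "y 0 = 0" "y' 0 = s" "y' T + F (y T) = x"
    using s by (auto simp: velocities_def)
  have ne: "\<bar>y t\<bar> \<noteq> ys" if "t \<in> {0..T}" for t
  proof
    assume "\<bar>y t\<bar> = ys"
    then have "G \<eta> (y t) = G \<eta> ys" using G_abs[of "y t"] by simp
    then have "(y' t)\<^sup>2 < 0" using ode_energy[OF y(1,2) that] y(3) \<open>s\<^sup>2 < _\<close> by (simp add: v0_sq)
    then show False by simp
  qed
  have "y T < ys"
  proof (rule ccontr)
    assume "\<not> y T < ys"
    then have "\<exists>t\<ge>0. t \<le> T \<and> y t = ys"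
      using y(2) T ys_pos ode_continuous(1)[OF y(1)] by (intro IVT') auto
    then obtain t where "t \<in> {0..T}" "y t = ys" by auto
    then show False using ne[of t] ys_pos by simp
  qed
  have en: "(x - F (y T))\<^sup>2 - G \<eta> (y T) = s\<^sup>2"
  proof -
    have "x - F (y T) = y' T" using y(4) by simp
    then show ?thesis using ode_energy[OF y(1,2), of T] y(3) T by simp
  qed
  show False
  proof (cases "0 \<le> y T")
    case True
    have "(v0 \<eta>)\<^sup>2 \<le> level xs (y T)" unfolding level_xs using xs_le_1 by simp
    also have "\<dots> \<le> level x (y T)" using True \<open>y T < ys\<close> x by (intro level_mono) auto
    also have "\<dots> = s\<^sup>2" using en True by (simp add: level_eq)
    finally show False using \<open>s\<^sup>2 < _\<close> by simp
  next
    case False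
    \<comment> \<open>For negative \<open>y T\<close> the comparison is with \<open>level\<close> at
      0: the cross term \<open>- 2 * x * F (y T)\<close> is then nonnegative.\<close>
    have "(v0 \<eta>)\<^sup>2 \<le> level xs 0" unfolding level_xs using xs_le_1 by simp
    also have "\<dots> = xs\<^sup>2" by (simp add: level_def)
    also have "\<dots> \<le> x\<^sup>2" using x xs_pos by (intro power_mono) auto
    also have "\<dots> \<le> x\<^sup>2 - 2 * x * F (y T) + (y T)\<^sup>2"
    proof -
      have "x * F (y T) \<le> 0" using False x xs_pos F_mono[of "y T" 0] by (intro mult_nonneg_nonpos) auto
      then show ?thesis using zero_le_power2[of "y T"] by linarith
    qed
    also have "\<dots> = s\<^sup>2" using en by (simp add: G_eq power2_diff)
    finally show False using \<open>s\<^sup>2 < _\<close> by simp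
  qed
qed

text \<open>The faster orbit ends at the larger \<open>y\<close>, while at a fixed end value the
  squared initial velocity \<open>level x y\<close> does not increase with \<open>y\<close>.\<close>

lemma velocities_unique_less:
  assumes s: "s \<in> velocities T x" and r: "r \<in> velocities T x"
    and x: "xs \<le> x" "x \<le> 1" and T: "0 < T"
  shows "\<not> s < r"
proof
  assume less: "s < r"
  have s0: "v0 \<eta> \<le> s" "v0 \<eta> \<le> r" using velocities_ge_v0 s r x T by auto
  obtain y y' where y: "ode T y y'" "y 0 = 0" "y' 0 = s" "y' T + F (y T) = x"
    using s by (auto simp: velocities_def)
  obtain z z' where z: "ode T z z'" "z 0 = 0" "z' 0 = r" "z' T + F (z T) = x"
    using r by (auto simp: velocities_def)
  have yz: "y T < z T" using outer_orbit_mono[OF y(1,2) z(1,2)] y z s0 less T by simp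
  have y0: "0 \<le> y T" using outer_orbit(2)[OF y(1,2), of T] y s0 T by simp
  have z0: "0 < z' T" using outer_orbit(1)[OF z(1,2), of T] z s0 T by simp
  have "level x (z T) \<le> level x (y T)" using yz y0 z0 z(4) x by (intro level_antimono) auto
  moreover have "level x (y T) = s\<^sup>2"
  proof -
    have "x - F (y T) = y' T" using y(4) by simp
    then show ?thesis using ode_energy[OF y(1,2), of T] y(3) T y0 by (simp add: level_eq)
  qed
  moreover have "level x (z T) = r\<^sup>2"
  proof -
    have "x - F (z T) = z' T" using z(4) by simp
    then show ?thesis using ode_energy[OF z(1,2), of T] z(3) T y0 yz by (simp add: level_eq)
  qed
  moreover have "s\<^sup>2 < r\<^sup>2" using less s0 v0_pos by (intro power_strict_mono) auto
  ultimately show False by simp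
qed

text \<open>The end position \<open>Y\<close> fixes the energy \<open>level x Y\<close> and thereby
  the travel time \<open>t Y\<close>. This time is 0 at \<open>Y = 0\<close> and reaches
  \<open>T\<close> before the first point \<open>Y1\<close> where the energy falls to
  \<open>(v0 \<eta>)^2\<close>.\<close>

lemma velocities_nonempty_friction:
  assumes eta: "0 < \<eta>" and x: "xs \<le> x" "x \<le> 1" and T: "0 < T"
  shows "velocities T x \<noteq> {}"
proof -
  have xpos: "0 < x" using x xs_pos by simp
  have "\<exists>Y\<ge>0. Y \<le> 2 \<and> F Y = x"
    using x xpos \<eta>_nonneg by (intro IVT') (auto simp: F_nonneg_eq intro!: continuous_intros continuous_on_F)
  \<comment> \<open>At \<open>Y2\<close> the end velocity vanishes, so
    \<open>level x Y2 = - G \<eta> Y2\<close> is at most \<open>(v0 \<eta>)^2\<close> and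
    \<open>A\<close> is nonempty.\<close>
  then obtain Y2 where Y2: "0 \<le> Y2" "F Y2 = x" by blast
  define A where "A = {Y \<in> {0..Y2}. level x Y \<le> (v0 \<eta>)\<^sup>2}"
  have levc: "continuous_on S (level x)" for S unfolding level_def by (intro continuous_intros)
  have "A = {0..Y2} \<inter> {Y. level x Y \<le> (v0 \<eta>)\<^sup>2}" by (auto simp: A_def)
  then have "closed A" by (auto intro!: closed_Int closed_Collect_le levc continuous_intros)
  moreover have "Y2 \<in> A" using Y2 G_ge_saddle[of Y2] by (simp add: A_def level_eq v0_sq)
  moreover have "bdd_below A" by (auto simp: A_def intro!: bdd_belowI)
  ultimately have "Inf A \<in> A" by (intro closed_contains_Inf) auto
  define Y1 where "Y1 = Inf A"
  have Y1: "0 \<le> Y1" "Y1 \<le> Y2" "level x Y1 \<le> (v0 \<eta>)\<^sup>2"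
    using \<open>Inf A \<in> A\<close> by (auto simp: A_def Y1_def)
  have above: "(v0 \<eta>)\<^sup>2 < level x Y" if "0 \<le> Y" "Y < Y1" for Y
  proof (rule ccontr)
    assume "\<not> ?thesis"
    then have "Y \<in> A" using that Y1 by (auto simp: A_def)
    then have "Y1 \<le> Y" unfolding Y1_def by (rule cInf_lower) fact
    then show False using that by simp
  qed
  \<comment> \<open>\<open>xs < 1\<close> keeps \<open>level xs\<close> strictly above
    \<open>(v0 \<eta>)^2\<close> below \<open>ys\<close>, so the integration range extends to the
    saddle as \<open>Y\<close> tends to \<open>Y1\<close>.\<close>
  have "ys \<le> Y1"
  proof (rule ccontr)
    assume "\<not> ys \<le> Y1"
    then have "(v0 \<eta>)\<^sup>2 < level xs Y1" unfolding level_xs using xs_less_1[OF eta] by simp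
    also have "\<dots> \<le> level x Y1" using x Y1 \<open>\<not> ys \<le> Y1\<close> by (intro level_mono) auto
    finally show False using Y1 by simp
  qed
  have pos: "0 < G \<eta> z + level x Y" if "0 \<le> Y" "Y < Y1" for z Y
    using above[OF that] G_ge_saddle[of z] by (simp add: v0_sq)
  define t where "t Y = integral {0..Y} (\<lambda>z. 1 / sqrt (G \<eta> z + level x Y))" for Y
  have cont: "continuous_on S (\<lambda>z. 1 / sqrt (G \<eta> z + level x Y))" if "0 \<le> Y" "Y < Y1" for Y S
    using pos[OF that] by (intro continuous_intros) (metis less_irrefl real_sqrt_gt_zero)
  \<comment> \<open>The cofactor in \<open>G_expand_saddle\<close>.\<close>
  define K where "K z = z\<^sup>2 / 4 + (2 * \<eta> + ys / 2) * z + \<eta> * ys + ys\<^sup>2 / 4" for z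
  have K: "0 < K ys" using ys_pos \<eta>_nonneg unfolding K_def by (intro add_nonneg_pos add_nonneg_nonneg) auto
  obtain e where e: "0 < e"
    "\<And>a h. \<lbrakk>ys / 2 \<le> a; continuous_on {0..a} h;
       \<And>u. u \<in> {0..a} \<Longrightarrow> 0 < h u \<and> h u \<le> 2 * K ys * ((a - u)\<^sup>2 + e)\<rbrakk>
       \<Longrightarrow> T \<le> integral {0..a} (\<lambda>u. 1 / sqrt (h u))"
    by (rule integral_inverse_sqrt_diverges[of "ys / 2" "2 * K ys" T]) (use K ys_pos in auto)
  \<comment> \<open>The left side of the last condition tends to at most 0 as \<open>Y\<close> tends
    to \<open>Y1\<close>. The minimum treats \<open>Y1 = ys\<close> and \<open>Y1 > ys\<close>
    together.\<close>
  obtain Y where Y: "ys / 2 < Y" "Y < Y1"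
    "2 * K ys * (ys - min Y ys)\<^sup>2 + (level x Y - (v0 \<eta>)\<^sup>2) < 2 * K ys * e"
  proof -
    let ?w = "\<lambda>Y. 2 * K ys * (ys - min Y ys)\<^sup>2 + (level x Y - (v0 \<eta>)\<^sup>2)"
    have "continuous_on UNIV ?w" by (intro continuous_intros levc)
    then have "(?w \<longlongrightarrow> ?w Y1) (at_left Y1)"
      by (auto simp: continuous_on_def filterlim_at_split)
    moreover have "?w Y1 < 2 * K ys * e" 
    proof -
      have "min Y1 ys = ys" using \<open>ys \<le> Y1\<close> by simp
      moreover have "0 < 2 * K ys * e" using K e(1) by simp
      ultimately show ?thesis using Y1(3) by (simp only: diff_self zero_power2 mult_zero_right)
    qed
    ultimately have "\<forall>\<^sub>F Y in at_left Y1. ?w Y < 2 * K ys * e" by (rule order_tendstoD(2))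
    moreover have "\<forall>\<^sub>F Y in at_left Y1. Y \<in> {ys / 2<..<Y1}"
      using ys_pos \<open>ys \<le> Y1\<close> by (intro eventually_at_left_real) simp
    ultimately have "\<forall>\<^sub>F Y in at_left Y1. ?w Y < 2 * K ys * e \<and> Y \<in> {ys / 2<..<Y1}" by eventually_elim simp
    then show thesis using that eventually_happens'[of "at_left Y1"] by auto
  qed
  have Y0: "0 \<le> Y" using Y ys_pos by simp
  have "T \<le> t Y"
  proof -
    define a where "a = min Y ys"
    have a: "0 \<le> a" "a \<le> Y" "a \<le> ys" "ys / 2 \<le> a" using Y ys_pos by (auto simp: a_def)
    have "T \<le> integral {0..a} (\<lambda>z. 1 / sqrt (G \<eta> z + level x Y))"
    proof (rule e(2)[OF a(4)])
      show "continuous_on {0..a} (\<lambda>z. G \<eta> z + level x Y)" by (intro continuous_intros)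
      fix z assume z: "z \<in> {0..a}"
      have "K z \<le> K ys"
        unfolding K_def using z a \<eta>_nonneg ys_pos
        by (intro add_mono divide_right_mono power_mono mult_left_mono) auto
      then have "G \<eta> z \<le> G \<eta> ys + (z - ys)\<^sup>2 * K ys"
        using G_expand_saddle[of z] z by (simp add: K_def[symmetric] mult_left_mono)
      \<comment> \<open>Splitting \<open>z - ys\<close> at \<open>a\<close> costs a factor 2, hence
        the constant \<open>2 * K ys\<close> in the choice of \<open>e\<close>.\<close>
      moreover have "(z - ys)\<^sup>2 \<le> 2 * (a - z)\<^sup>2 + 2 * (ys - a)\<^sup>2"
        using zero_le_power2[of "(a - z) - (ys - a)"] by (simp add: power2_eq_square algebra_simps)
      then have "(z - ys)\<^sup>2 * K ys \<le> (2 * (a - z)\<^sup>2 + 2 * (ys - a)\<^sup>2) * K ys"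
        using K by (intro mult_right_mono) auto
      ultimately have "G \<eta> z + level x Y \<le> 2 * K ys * ((a - z)\<^sup>2 + e)"
        using Y(3) by (simp add: v0_sq a_def[symmetric] algebra_simps)
      then show "0 < G \<eta> z + level x Y \<and> G \<eta> z + level x Y \<le> 2 * K ys * ((a - z)\<^sup>2 + e)"
        using pos[OF Y0 Y(2)] by simp
    qed
    also have "\<dots> \<le> t Y"
      unfolding t_def using a pos[OF Y0 Y(2)]
      by (intro integral_subset_le integrable_continuous_real cont Y0 Y(2)) (auto intro: less_imp_le)
    finally show ?thesis .
  qed
  have "continuous_on {0..Y} t"
    unfolding t_def
  proof (rule continuous_on_integral_upper)
    have "sqrt (G \<eta> z + level x W) \<noteq> 0" if "W \<in> {0..Y}" for W z
      using pos[of W z] that Y by simp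
    then show "continuous_on ({0..Y} \<times> {0..1}) (\<lambda>(W, u). 1 / sqrt (G \<eta> (W * u) + level x W))"
      unfolding case_prod_unfold level_def by (intro continuous_intros) (auto simp: level_def)
  qed (auto intro: continuous_intros)
  then have "\<exists>W\<ge>0. W \<le> Y \<and> t W = T"
    using \<open>T \<le> t Y\<close> T Y0 by (intro IVT') (auto simp: t_def)
  then obtain W where W: "0 \<le> W" "W \<le> Y" "t W = T" by blast
  have W1: "W < Y1" using W Y by simp
  obtain y y' where y: "ode T y y'" "y 0 = 0" "y T = W" "y' T = sqrt (G \<eta> W + level x W)"
    using energy_solution[OF W(1) pos[OF W(1) W1] W(3)[unfolded t_def]] by blast
  have "F W \<le> x" using F_mono[of W Y2] W1 Y1 Y2 by simp
  then have "y' T + F (y T) = x" using y W(1) by (simp add: level_eq)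
  then have "y' 0 \<in> velocities T x" using y unfolding velocities_def by blast
  then show ?thesis by blast
qed

text \<open>For \<open>\<eta> = 0\<close> one has \<open>xs = 1\<close> and \<open>level 1\<close>
  is constantly \<open>(v0 \<eta>)^2\<close>, so no range of energies is left to vary. The end value
  1 is reached along the separatrix, which is explicit.\<close>

lemma velocities_nonempty_frictionless:
  assumes "\<eta> = 0" "0 \<le> T"
  shows "velocities T 1 \<noteq> {}"
proof -
  let ?y = "\<lambda>t. sqrt 2 * tanh (t / sqrt 2)" and ?y' = "\<lambda>t. 1 - (tanh (t / sqrt 2))\<^sup>2"
  have "ode T ?y ?y'"
    unfolding ode_def
  proof (intro ballI conjI)
    fix t
    show "(?y has_real_derivative ?y' t) (at t within {0..T})"
      by (auto intro!: derivative_eq_intros simp: mult.assoc algebra_simps)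
    have "(?y' has_real_derivative - (2 * tanh (t / sqrt 2) * (?y' t / sqrt 2))) (at t within {0..T})"
      by (auto intro!: derivative_eq_intros simp: field_simps) (simp flip: mult.assoc)
    also have "- (2 * tanh (t / sqrt 2) * (?y' t / sqrt 2)) = force (?y t)"
    proof -
      have "2 / sqrt 2 = sqrt (2::real)" by (simp add: real_div_sqrt)
      moreover have "- (2 * u * ((1 - u\<^sup>2) / sqrt 2)) = - (2 / sqrt 2 * (u * (1 - u\<^sup>2)))" for u :: real by simp
      ultimately have *: "- (2 * u * ((1 - u\<^sup>2) / sqrt 2)) = - (sqrt 2 * (u * (1 - u\<^sup>2)))" for u :: real
        by simp
      have "sqrt 2 ^ 3 = 2 * sqrt (2::real)" by (simp add: power3_eq_cube)
      then have f: "force (sqrt 2 * u) = sqrt 2 * u ^ 3 - sqrt 2 * u" for u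
        using assms(1) unfolding force_def by (simp add: power_mult_distrib)
      show ?thesis
        unfolding * f by (simp add: power2_eq_square power3_eq_cube algebra_simps)
    qed
    finally show "(?y' has_real_derivative force (?y t)) (at t within {0..T})" .
  qed
  \<comment> \<open>\<open>F\<close> of this orbit is the square of the hyperbolic tangent, so the
    state is 1 throughout.\<close>
  moreover have "?y' T + F (?y T) = 1"
  proof -
    have "0 \<le> ?y T" using assms(2) by simp
    then show ?thesis unfolding F_nonneg_eq[OF \<open>0 \<le> ?y T\<close>] using assms(1) by (simp add: power_mult_distrib)
  qed
  ultimately have "?y' 0 \<in> velocities T 1"
    unfolding velocities_def by (intro CollectI exI[of _ ?y] exI[of _ ?y']) auto
  then show ?thesis by blast
qed

lemma velocities_singleton:
  assumes x: "xs \<le> x" "x \<le> 1" and T: "0 < T"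
  shows "\<exists>s. velocities T x = {s}"
proof -
  have "velocities T x \<noteq> {}"
  proof (cases "\<eta> = 0")
    case True
    then have "xs = 1" unfolding xs_def by simp
    then have "x = 1" using x by simp
    then show ?thesis using velocities_nonempty_frictionless[OF True] T by simp
  next
    case False
    then show ?thesis using velocities_nonempty_friction x T \<eta>_nonneg by simp
  qed
  then obtain s where "s \<in> velocities T x" by blast
  then have "velocities T x = {s}"
    using velocities_unique_less[OF _ _ x T, of s] velocities_unique_less[OF _ _ x T, of _ s]
    by (auto intro: antisym simp: not_less)
  then show ?thesis by blast
qed

end

section \<open>Transfer to the boundary value problem\<close>

theorem proposition3p2:
  fixes \<eta> \<theta> :: real
  assumes "0 \<le> \<eta>" and "\<eta> < 1/2" and "0 \<le> \<theta>" and "\<theta> \<le> 1"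
  shows
    "(\<bar>2 * \<theta> - 1\<bar> \<ge> 1 - \<eta>^2 - \<eta> * sqrt (\<eta>^2 + 2) \<longrightarrow>
        (\<forall>T>0. \<exists>!y. y \<in> solutions_P \<eta> T \<theta>)) \<and>
     (\<bar>2 * \<theta> - 1\<bar> < 1 - \<eta>^2 - \<eta> * sqrt (\<eta>^2 + 2) \<longrightarrow>
        (\<forall>n::nat. \<exists>Tstar>0. \<forall>T\<ge>Tstar.
           \<exists>S \<subseteq> solutions_P \<eta> T \<theta>. finite S \<and> card S = n)) \<and>
     (2 * \<theta> - 1 = 0 \<longrightarrow>
        (\<forall>T>0. finite (solutions_P \<eta> T \<theta>) \<and>
           enat (card (solutions_P \<eta> T \<theta>)) =
             1 + 2 * (SUP k\<in>{k::nat. 1 \<le> k \<and> Tk0 \<eta> k < T}. enat k)))"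
proof -
  interpret mfg \<eta> using assms by unfold_locales
  define x where "x = 2 * \<theta> - 1"
  have x1: "\<bar>x\<bar> \<le> 1" using assms by (auto simp: x_def)
  \<comment> \<open>Reflection replaces the end value by its absolute value.\<close>
  have vel: "velocities T x = velocities T \<bar>x\<bar> \<or> velocities T x = uminus ` velocities T \<bar>x\<bar>" for T
    using velocities_minus[of T "\<bar>x\<bar>"] by (cases "x \<ge> 0") auto
  have bij: "\<exists>f. bij_betw f (solutions_P \<eta> T \<theta>) (velocities T x)" if "0 < T" for T
    using bij_solutions_velocities[OF that, of \<theta>] by (simp add: x_def)
  have 1: "\<exists>!y. y \<in> solutions_P \<eta> T \<theta>" if xx: "xs \<le> \<bar>x\<bar>" and T: "0 < T" for T
  proof -
    obtain s where "velocities T \<bar>x\<bar> = {s}" using velocities_singleton[OF xx x1 T] by blast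
    then have "\<exists>s. velocities T x = {s}" using vel[of T] by auto
    then obtain s where "velocities T x = {s}" by blast
    with bij[OF T] obtain f where "bij_betw f (solutions_P \<eta> T \<theta>) {s}" by auto
    then have "card (solutions_P \<eta> T \<theta>) = 1" by (simp add: bij_betw_same_card)
    then show ?thesis by (auto simp: card_1_singleton_iff)
  qed
  have 2: "\<exists>Tstar>0. \<forall>T\<ge>Tstar. \<exists>S\<subseteq>solutions_P \<eta> T \<theta>. finite S \<and> card S = n" if "\<bar>x\<bar> < xs" for n
  proof -
    obtain T0 where T0: "0 < T0" "\<And>T. T0 \<le> T \<Longrightarrow> \<exists>S\<subseteq>velocities T \<bar>x\<bar>. finite S \<and> card S = n"
      using many_velocities[of "\<bar>x\<bar>" n] \<open>\<bar>x\<bar> < xs\<close> by auto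
    have "\<exists>S\<subseteq>solutions_P \<eta> T \<theta>. finite S \<and> card S = n" if T: "T0 \<le> T" for T
    proof -
      have pos: "0 < T" using T T0(1) by simp
      obtain S where S: "S \<subseteq> velocities T \<bar>x\<bar>" "finite S" "card S = n" using T0(2)[OF T] by blast
      obtain S' where S': "S' \<subseteq> velocities T x" "finite S'" "card S' = n"
        using vel[of T]
      proof
        assume "velocities T x = uminus ` velocities T \<bar>x\<bar>"
        then show thesis using S by (intro that[of "uminus ` S"]) (auto simp: card_image)
      qed (use S that in auto)
      obtain f where f: "bij_betw f (solutions_P \<eta> T \<theta>) (velocities T x)" using bij[OF pos] by blast
      then obtain U where "U \<subseteq> solutions_P \<eta> T \<theta>" "S' = f ` U"
        using S'(1) by (metis bij_betw_imp_surj_on subset_imageE)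
      moreover have "inj_on f U" using f \<open>U \<subseteq> _\<close> by (auto simp: bij_betw_def intro: inj_on_subset)
      ultimately show ?thesis
        using S' by (intro exI[of _ U]) (auto simp: card_image finite_image_iff)
    qed
    with T0(1) show ?thesis by blast
  qed
  have 3: "finite (solutions_P \<eta> T \<theta>) \<and> enat (card (solutions_P \<eta> T \<theta>)) =
      1 + 2 * (SUP k\<in>{k::nat. 1 \<le> k \<and> Tk0 \<eta> k < T}. enat k)" if x0: "x = 0" and T: "0 < T" for T
  proof -
    obtain f where f: "bij_betw f (solutions_P \<eta> T \<theta>) (velocities T 0)" using bij[OF T] x0 by auto
    then show ?thesis
      using card_velocities_0[OF T] bij_betw_same_card[OF f] bij_betw_finite[OF f] by simp
  qed
  from 1 2 3 show ?thesis unfolding x_def xs_def by blast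
qed

end
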